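(* Let $\theta$ be an arbitrary irrational number, and let $\alpha$ be a concave modulus such that \[\int_0^1\frac{1}{\alpha(x)}\,dx<\infty.\] Then there exists an exceptional diffeomorphism $f\in\mathrm{Diff}_+^{1,\alpha}(S^1)$ with rotation number $\theta$ (mod $1$). Moreover, $f$ may be chosen arbitrarily $C^1$-close to the rotation by $\theta$; that is, for every $\epsilon>0$ one may choose such an $f$ with $\sup_x|f(x)-(x+\theta)|<\epsilon$ and $\sup_x|f'(x)-1|<\epsilon$.
   Context: $S^1=\mathbb R/\mathbb Z$, and $|x-y|$ for $x,y\in S^1$ is the distance modulo $1$. A concave modulus is a homeomorphism $\alpha\colon[0,\infty)\to[0,\infty)$ that is concave. A function $g\colon S^1\to\mathbb R$ is $\alpha$-continuous if $\sup_{x\neq y}|g(x)-g(y)|/\alpha(|x-y|)<\infty$. $\mathrm{Diff}_+^{1,\alpha}(S^1)$ is the group of orientation-preserving $C^1$ diffeomorphisms of $S^1$ with $\alpha$-continuous derivative. A diffeomorphism $f$ of $S^1$ with irrational rotation number is exceptional if it is not topologically conjugate to a rotation; equivalently, it has a minimal closed invariant set homeomorphic to a Cantor set (an exceptional minimal set). *)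

theory Defs
  imports "HOL-Analysis.Analysis"
begin

section \<open>The circle\<close>

quotient_type circle = real / "\<lambda>x y :: real. x - y \<in> \<int>"
  morphisms rep_circle proj
proof (rule equivpI)
  show "reflp (\<lambda>x y :: real. x - y \<in> \<int>)"
    by (simp add: reflp_def)
  show "symp (\<lambda>x y :: real. x - y \<in> \<int>)"
  proof (rule sympI)
    fix x y :: real
    assume "x - y \<in> \<int>"
    then have "- (x - y) \<in> \<int>" by (rule Ints_minus)
    then show "y - x \<in> \<int>" by simp
  qed
  show "transp (\<lambda>x y :: real. x - y \<in> \<int>)"
  proof (rule transpI)
    fix x y z :: real
    assume "x - y \<in> \<int>" "y - z \<in> \<int>"
    then have "(x - y) + (y - z) \<in> \<int>" by (rule Ints_add)
    then show "x - z \<in> \<int>" by simp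
  qed
qed

lemma proj_eq_iff: "proj x = proj y \<longleftrightarrow> x - y \<in> \<int>"
  by (rule circle.abs_eq_iff)

lemma proj_surj: "\<exists>x. p = proj x"
  by (rule circle.abs_induct) blast

text \<open>The nearest integer to \<open>t\<close> is \<open>round t\<close>; ties do not matter for the distance.\<close>

definition dist_to_Ints :: "real \<Rightarrow> real" where
  "dist_to_Ints t = \<bar>t - of_int (round t)\<bar>"

lemma dist_to_Ints_le: "dist_to_Ints t \<le> \<bar>t - of_int k\<bar>"
  unfolding dist_to_Ints_def by (rule round_diff_minimal)

lemma dist_to_Ints_cong:
  assumes "s - t \<in> \<int>"
  shows "dist_to_Ints s = dist_to_Ints t"
proof -
  from assms obtain k where "s - t = of_int k" by (rule Ints_cases)
  then have k: "s = t + of_int k" by simp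
  show ?thesis
  proof (rule antisym)
    show "dist_to_Ints s \<le> dist_to_Ints t"
      using dist_to_Ints_le[of s "round t + k"] by (simp add: k dist_to_Ints_def)
    show "dist_to_Ints t \<le> dist_to_Ints s"
      using dist_to_Ints_le[of t "round s - k"] by (simp add: k dist_to_Ints_def algebra_simps)
  qed
qed

lemma dist_to_Ints_uminus: "dist_to_Ints (- t) = dist_to_Ints t"
proof (rule antisym)
  show "dist_to_Ints (- t) \<le> dist_to_Ints t" for t
    using dist_to_Ints_le[of "- t" "- round t"] by (simp add: dist_to_Ints_def abs_minus_commute)
  from this[of "- t"] show "dist_to_Ints t \<le> dist_to_Ints (- t)" by simp
qed

lemma dist_to_Ints_add_le: "dist_to_Ints (s + t) \<le> dist_to_Ints s + dist_to_Ints t"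
  using dist_to_Ints_le[of "s + t" "round s + round t"] by (simp add: dist_to_Ints_def)

lemma dist_to_Ints_eq_0_iff: "dist_to_Ints t = 0 \<longleftrightarrow> t \<in> \<int>"
proof
  assume "dist_to_Ints t = 0"
  then have "t = of_int (round t)" by (simp add: dist_to_Ints_def)
  then show "t \<in> \<int>" by (metis Ints_of_int)
next
  assume "t \<in> \<int>"
  then obtain k where "t = of_int k" by (rule Ints_cases)
  then show "dist_to_Ints t = 0" by (simp add: dist_to_Ints_def)
qed

instantiation circle :: metric_space
begin

lift_definition dist_circle :: "circle \<Rightarrow> circle \<Rightarrow> real" is "\<lambda>x y. dist_to_Ints (x - y)"
proof (rule dist_to_Ints_cong)
  fix x x' y y' :: real
  assume "x - x' \<in> \<int>" "y - y' \<in> \<int>"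
  then have "(x - x') - (y - y') \<in> \<int>" by (rule Ints_diff)
  then show "x - y - (x' - y') \<in> \<int>" by (simp add: algebra_simps)
qed

definition uniformity_circle :: "(circle \<times> circle) filter" where
  "uniformity_circle = (INF e\<in>{0<..}. principal {(p, q). dist p q < e})"

definition open_circle :: "circle set \<Rightarrow> bool" where
  "open_circle U = (\<forall>p\<in>U. eventually (\<lambda>(p', q). p' = p \<longrightarrow> q \<in> U) uniformity)"

instance
proof
  fix p q r :: circle
  show "(dist p q = 0) = (p = q)"
    by transfer (rule dist_to_Ints_eq_0_iff)
  show "dist p q \<le> dist p r + dist q r"
  proof transfer
    fix x y z :: real
    show "dist_to_Ints (x - y) \<le> dist_to_Ints (x - z) + dist_to_Ints (y - z)"
      using dist_to_Ints_add_le[of "x - z" "z - y"] dist_to_Ints_uminus[of "y - z"] by simp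
  qed
qed (simp_all add: uniformity_circle_def open_circle_def)

end

lemma dist_proj: "dist (proj x) (proj y) = dist_to_Ints (x - y)"
  by (rule dist_circle.abs_eq)

lift_definition rotation :: "real \<Rightarrow> circle \<Rightarrow> circle" is "\<lambda>t x. x + t"
  by simp

lemma rotation_proj: "rotation t (proj x) = proj (x + t)"
  by (rule rotation.abs_eq)


section \<open>Lifts and circle diffeomorphisms\<close>

definition is_lift :: "(real \<Rightarrow> real) \<Rightarrow> (circle \<Rightarrow> circle) \<Rightarrow> bool" where
  "is_lift F f \<longleftrightarrow> continuous_on UNIV F \<and> (\<forall>x. f (proj x) = proj (F x))"

lemma is_lift_unique:
  assumes "is_lift F f" "is_lift G f"
  shows "\<exists>k::int. \<forall>x. F x = G x + of_int k"
proof -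
  have Z: "F x - G x \<in> \<int>" for x
  proof -
    have "proj (F x) = f (proj x)" "proj (G x) = f (proj x)"
      using assms by (simp_all add: is_lift_def)
    then have "proj (F x) = proj (G x)" by simp
    then show ?thesis by (rule proj_eq_iff[THEN iffD1])
  qed
  have "(\<lambda>x. F x - G x) constant_on UNIV"
  proof (rule continuous_discrete_range_constant)
    show "continuous_on UNIV (\<lambda>x. F x - G x)"
      using assms by (auto simp: is_lift_def intro: continuous_on_diff)
    show "\<exists>e>0. \<forall>y. y \<in> UNIV \<and> F y - G y \<noteq> F x - G x
             \<longrightarrow> e \<le> norm (F y - G y - (F x - G x))" for x
    proof (intro exI[of _ 1] conjI allI impI)
      fix y assume "y \<in> UNIV \<and> F y - G y \<noteq> F x - G x"
      moreover have "F y - G y - (F x - G x) \<in> \<int>" by (intro Ints_diff Z)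
      ultimately show "1 \<le> norm (F y - G y - (F x - G x))"
        by (simp add: Ints_nonzero_abs_ge1)
    qed simp
  qed simp
  then obtain c where c: "\<And>x. F x - G x = c"
    by (auto simp: constant_on_def)
  from Z[of 0] obtain k where "F 0 - G 0 = of_int k" by (rule Ints_cases)
  with c have "F x - G x = of_int k" for x by simp
  then have "F x = G x + of_int k" for x by (simp add: algebra_simps)
  then show ?thesis by blast
qed

text \<open>
  The derivative at \<open>p\<close> is that of any lift at any point over \<open>p\<close>; it does not depend on the choices,
  by \<open>has_circle_deriv_unique\<close> below.
\<close>

definition has_circle_deriv :: "(circle \<Rightarrow> circle) \<Rightarrow> real \<Rightarrow> circle \<Rightarrow> bool" where
  "has_circle_deriv f d p \<longleftrightarrow>
     (\<exists>F x. is_lift F f \<and> proj x = p \<and> (F has_real_derivative d) (at x))"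

definition circle_deriv :: "(circle \<Rightarrow> circle) \<Rightarrow> circle \<Rightarrow> real" where
  "circle_deriv f p = (THE d. has_circle_deriv f d p)"

lemma has_circle_deriv_unique:
  assumes "has_circle_deriv f d p" "has_circle_deriv f e p"
  shows "d = e"
proof -
  from assms(1) obtain F x where F: "is_lift F f" "proj x = p" "(F has_real_derivative d) (at x)"
    by (auto simp: has_circle_deriv_def)
  from assms(2) obtain G y where G: "is_lift G f" "proj y = p" "(G has_real_derivative e) (at y)"
    by (auto simp: has_circle_deriv_def)
  define m where "m = y - x"
  have m: "m \<in> \<int>" using F(2) G(2) proj_eq_iff m_def by metis
  have "is_lift (\<lambda>z. G (z + m)) f"
  proof -
    have "f (proj z) = proj (G (z + m))" for z
    proof -
      have "proj z = proj (z + m)" using m by (simp add: proj_eq_iff)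
      then show ?thesis using G(1) by (simp add: is_lift_def)
    qed
    moreover have "continuous_on UNIV (\<lambda>z. G (z + m))"
      using G(1) by (auto simp: is_lift_def intro!: continuous_on_compose2[of UNIV G] continuous_intros)
    ultimately show ?thesis by (simp add: is_lift_def)
  qed
  then obtain k :: int where k: "F = (\<lambda>z. G (z + m) + of_int k)"
    using is_lift_unique[OF F(1)] by fast
  have "((\<lambda>z. G (z + m)) has_real_derivative e) (at x)"
    using G(3) DERIV_shift[of G e x m] by (simp add: m_def)
  then have "(F has_real_derivative e) (at x)"
    unfolding k by (auto intro!: derivative_eq_intros)
  with F(3) show ?thesis by (rule DERIV_unique)
qed

lemma circle_deriv_proj:
  assumes "is_lift F f" "(F has_real_derivative d) (at x)"
  shows "circle_deriv f (proj x) = d"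
proof -
  have "has_circle_deriv f d (proj x)"
    using assms by (auto simp: has_circle_deriv_def)
  then show ?thesis
    unfolding circle_deriv_def using has_circle_deriv_unique by blast
qed

definition C1_circle_map :: "(circle \<Rightarrow> circle) \<Rightarrow> bool" where
  "C1_circle_map f \<longleftrightarrow>
     (\<forall>p. \<exists>d. has_circle_deriv f d p) \<and> continuous_on UNIV (circle_deriv f)"

definition orientation_preserving :: "(circle \<Rightarrow> circle) \<Rightarrow> bool" where
  "orientation_preserving f \<longleftrightarrow> (\<exists>F. is_lift F f \<and> strict_mono F)"

definition Diff1_plus :: "(circle \<Rightarrow> circle) set" where
  "Diff1_plus =
     {f. bij f \<and> C1_circle_map f \<and> C1_circle_map (inv f) \<and> orientation_preserving f}"


section \<open>Moduli of continuity\<close>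

definition concave_modulus :: "(real \<Rightarrow> real) \<Rightarrow> bool" where
  "concave_modulus \<alpha> \<longleftrightarrow>
     (\<exists>\<beta>. homeomorphism {0..} {0..} \<alpha> \<beta>) \<and> concave_on {0..} \<alpha>"

definition alpha_continuous :: "(real \<Rightarrow> real) \<Rightarrow> (circle \<Rightarrow> real) \<Rightarrow> bool" where
  "alpha_continuous \<alpha> g \<longleftrightarrow>
     bdd_above {\<bar>g p - g q\<bar> / \<alpha> (dist p q) | p q. p \<noteq> q}"

definition Diff1_alpha_plus :: "(real \<Rightarrow> real) \<Rightarrow> (circle \<Rightarrow> circle) set" where
  "Diff1_alpha_plus \<alpha> = {f \<in> Diff1_plus. alpha_continuous \<alpha> (circle_deriv f)}"


section \<open>Rotation number and exceptional diffeomorphisms\<close>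

text \<open>
  Lifts of \<open>f\<close> differ by integers, and adding \<open>k\<close> to \<open>F\<close> adds \<open>k\<close> to the limit, so quantifying
  existentially over the lift makes this a property of \<open>\<rho>\<close> modulo 1.
\<close>

definition has_rotation_number :: "(circle \<Rightarrow> circle) \<Rightarrow> real \<Rightarrow> bool" where
  "has_rotation_number f \<rho> \<longleftrightarrow>
     (\<exists>F. is_lift F f \<and> strict_mono F \<and>
          (\<forall>x. (\<lambda>n. ((F ^^ n) x - x) / real n) \<longlonglongrightarrow> \<rho>))"

definition topologically_conjugate ::
    "('a::topological_space \<Rightarrow> 'a) \<Rightarrow> ('b::topological_space \<Rightarrow> 'b) \<Rightarrow> bool" where
  "topologically_conjugate f g \<longleftrightarrow>
     (\<exists>h h'. homeomorphism UNIV UNIV h h' \<and> h \<circ> f = g \<circ> h)"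

definition exceptional :: "(circle \<Rightarrow> circle) \<Rightarrow> bool" where
  "exceptional f \<longleftrightarrow>
     f \<in> Diff1_plus \<and> (\<exists>\<rho>. \<rho> \<notin> \<rat> \<and> has_rotation_number f \<rho>) \<and>
     \<not> (\<exists>t. topologically_conjugate f (rotation t))"

end

theory Submission
  imports Defs
begin

text \<open>
  Denjoy's construction: insert into the circle gaps of lengths \<open>\<ell>\<^sub>n\<close> (\<open>n \<in> \<int>\<close>) of small total
  length at the points of an orbit of the rotation, keeping the remaining Lebesgue measure, and
  let \<open>f\<close> map the \<open>n\<close>-th gap to the next one with derivative \<open>1 + (\<ell>\<^sub>n\<^sub>+\<^sub>1 / \<ell>\<^sub>n - 1) \<phi>\<close>, where \<open>\<phi>\<close> is
  a tent of height 2 and Lipschitz constant \<open>4 / \<ell>\<^sub>n\<close> on the gap; outside the gaps \<open>f' = 1\<close>. By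
  concavity \<open>f'\<close> is \<open>\<alpha>\<close>-continuous once \<open>\<bar>\<ell>\<^sub>n\<^sub>+\<^sub>1 / \<ell>\<^sub>n - 1\<bar> \<le> C \<alpha>(\<ell>\<^sub>n)\<close>. Taking \<open>\<ell>\<^sub>n\<^sub>+\<^sub>1 = \<ell>\<^sub>n (1 - \<alpha>(\<ell>\<^sub>n))\<close> for
  \<open>n \<ge> 0\<close> and \<open>\<ell>\<^sub>-\<^sub>n = \<ell>\<^sub>n\<close> achieves this, and
  \<open>\<ell>\<^sub>n = (\<ell>\<^sub>n - \<ell>\<^sub>n\<^sub>+\<^sub>1) / \<alpha>(\<ell>\<^sub>n)\<close> is at most the integral of \<open>1 / \<alpha>\<close> over \<open>[\<ell>\<^sub>n\<^sub>+\<^sub>1, \<ell>\<^sub>n]\<close>, so the lengths are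
  summable. Dropping an initial part of the sequence makes everything as small as desired.
\<close>

section \<open>Concave moduli and gap lengths\<close>

text \<open>A concave function that drops once keeps dropping at least linearly and becomes
  negative, while \<open>\<alpha>\<close> takes values in \<open>{0..}\<close>.\<close>

lemma concave_modulus_mono:
  assumes "concave_modulus \<alpha>" "0 \<le> s" "s \<le> t"
  shows "\<alpha> s \<le> \<alpha> t"
proof (rule ccontr)
  assume lt: "\<not> \<alpha> s \<le> \<alpha> t"
  then have st: "s < t" using assms(3) by (cases "s = t") auto
  from assms(1) obtain \<beta> where h: "homeomorphism {0..} {0..} \<alpha> \<beta>" and c: "concave_on {0..} \<alpha>"
    by (auto simp: concave_modulus_def)
  have nonneg: "\<alpha> x \<ge> 0" if "x \<ge> 0" for x
    using h that by (auto simp: homeomorphism_def)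
  \<comment> \<open>\<open>l * \<alpha> s\<close> is half of the drop, and \<open>T\<close> below is
    placed so that \<open>t\<close> divides the segment from \<open>s\<close> to \<open>T\<close>
    with weight \<open>l\<close>; concavity then bounds the drop by its half.\<close>
  define l where "l = (\<alpha> s - \<alpha> t) / (2 * \<alpha> s)"
  have "\<alpha> t \<ge> 0" using nonneg assms by auto
  with lt have l: "0 < l" "l < 1" "l * \<alpha> s = (\<alpha> s - \<alpha> t) / 2"
    by (auto simp: l_def field_simps)
  define T where "T = s + (t - s) / l"
  have "l * T = l * s + (t - s)" using l(1) by (simp add: T_def distrib_left)
  then have T: "T \<ge> 0" "t = (1 - l) * s + l * T"
    using l(1) st assms(2) by (auto simp: T_def left_diff_distrib)
  have "(1 - l) * \<alpha> s + l * \<alpha> T \<le> \<alpha> ((1 - l) *\<^sub>R s + l *\<^sub>R T)"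
    using c l T(1) assms(2) by (intro concave_onD[OF c]) auto
  also have "\<dots> = \<alpha> t" using T(2) by simp
  finally have "(1 - l) * \<alpha> s + l * \<alpha> T \<le> \<alpha> t" .
  moreover have "l * \<alpha> T \<ge> 0" using l T nonneg by simp
  ultimately have "\<alpha> s - l * \<alpha> s \<le> \<alpha> t" by (simp add: algebra_simps)
  then show False using l(3) lt by argo
qed

lemma concave_modulus_0:
  assumes "concave_modulus \<alpha>"
  shows "\<alpha> 0 = 0"
proof -
  from assms obtain \<beta> where h: "homeomorphism {0..} {0..} \<alpha> \<beta>"
    by (auto simp: concave_modulus_def)
  then have "\<alpha> ` {0..} = {0..}" by (auto simp: homeomorphism_def)
  then have a: "(0::real) \<in> \<alpha> ` {0..}" "\<alpha> 0 \<in> {0..}" by auto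
  then obtain z where "z \<ge> 0" "\<alpha> z = 0" by auto
  with concave_modulus_mono[OF assms, of 0 z] a show ?thesis by auto
qed

lemma concave_modulus_pos:
  assumes "concave_modulus \<alpha>" "0 < x"
  shows "0 < \<alpha> x"
proof -
  from assms obtain \<beta> where h: "homeomorphism {0..} {0..} \<alpha> \<beta>"
    by (auto simp: concave_modulus_def)
  then have "\<beta> (\<alpha> x) = x" "\<beta> (\<alpha> 0) = 0" using assms(2) by (auto simp: homeomorphism_def)
  then have "\<alpha> x \<noteq> \<alpha> 0" using assms(2) by auto
  then show ?thesis
    using concave_modulus_mono[OF assms(1), of 0 x] concave_modulus_0[OF assms(1)] assms(2) by auto
qed

text \<open>Concavity on the chord from the origin; equivalently, \<open>\<alpha> t / t\<close> does
  not increase.\<close>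

lemma concave_modulus_ratio:
  assumes "concave_modulus \<alpha>" "0 \<le> r" "r \<le> 1" "0 \<le> t"
  shows "r * \<alpha> t \<le> \<alpha> (r * t)"
proof -
  from assms have c: "concave_on {0..} \<alpha>" by (auto simp: concave_modulus_def)
  have "(1 - r) * \<alpha> 0 + r * \<alpha> t \<le> \<alpha> ((1 - r) *\<^sub>R 0 + r *\<^sub>R t)"
    using assms by (intro concave_onD[OF c]) auto
  then show ?thesis using concave_modulus_0[OF assms(1)] by simp
qed

lemma concave_modulus_continuous:
  assumes "concave_modulus \<alpha>"
  shows "continuous_on {0..} \<alpha>"
  using assms by (auto simp: concave_modulus_def homeomorphism_def)

lemma concave_modulus_small:
  assumes "concave_modulus \<alpha>" "0 < e"
  obtains d where "0 < d" "d \<le> 1" "\<alpha> d \<le> e"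
proof -
  from concave_modulus_continuous[OF assms(1)] assms(2)
  obtain d where d: "d > 0" "\<And>x. x \<ge> 0 \<Longrightarrow> dist x 0 < d \<Longrightarrow> dist (\<alpha> x) (\<alpha> 0) < e"
    unfolding continuous_on_iff by (metis atLeast_iff order_refl)
  have "dist (\<alpha> (min 1 (d/2))) (\<alpha> 0) < e"
    using d(1) by (intro d(2)) (auto simp: dist_real_def)
  then have "\<alpha> (min 1 (d/2)) \<le> e" by (simp add: concave_modulus_0[OF assms(1)] dist_real_def)
  with d(1) show ?thesis by (intro that[of "min 1 (d/2)"]) auto
qed

text \<open>Converts the truncated Lipschitz bound of a tent on a gap of length \<open>l\<close>
  into a bound by the modulus: concavity serves distances below \<open>l\<close>, monotonicity those
  above.\<close>

lemma concave_modulus_min: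
  assumes "concave_modulus \<alpha>" "0 < l" "0 \<le> d"
  shows "\<alpha> l * min 1 (d / l) \<le> \<alpha> d"
proof (cases "d \<le> l")
  case True
  then have "\<alpha> l * min 1 (d / l) = (d / l) * \<alpha> l" using assms by (simp add: min_def field_simps)
  also have "\<dots> \<le> \<alpha> (d / l * l)"
    using True assms by (intro concave_modulus_ratio[OF assms(1)]) (auto simp: field_simps)
  finally show ?thesis using assms by simp
next
  case False
  have "min 1 (d / l) = 1" using assms False by (auto simp: min_def field_simps)
  moreover have "\<alpha> l \<le> \<alpha> d"
    using False assms by (intro concave_modulus_mono[OF assms(1)]) auto
  ultimately show ?thesis by simp
qed

text \<open>
  The recursion discretises the differential equation \<open>\<ell>' = - \<ell> \<alpha>(\<ell>)\<close>, for which
  \<open>\<ell> dt = - d\<ell> / \<alpha>(\<ell>)\<close>; hence the integral of \<open>1 / \<alpha>\<close> bounds the sum of the lengths.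
\<close>

lemma nn_integral_inverse_modulus_step:
  assumes \<alpha>: "concave_modulus \<alpha>" and x: "0 < x" and le: "\<alpha> x < 1"
  shows "ennreal x + (\<integral>\<^sup>+ t\<in>{0..x * (1 - \<alpha> x)}. ennreal (1 / \<alpha> t) \<partial>lborel)
    \<le> (\<integral>\<^sup>+ t\<in>{0..x}. ennreal (1 / \<alpha> t) \<partial>lborel)"
proof -
  define y where "y = x * (1 - \<alpha> x)"
  \<comment> \<open>Constant extension to the negative axis, where nothing is known of
    \<open>\<alpha>\<close>, so that measurability follows from continuity.\<close>
  define a where "a t = \<alpha> (max 0 t)" for t
  have pos: "\<alpha> x > 0" by (rule concave_modulus_pos[OF \<alpha> x])
  have y: "0 < y" "y < x" using pos le x by (auto simp: y_def)
  have "continuous_on UNIV a"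
    unfolding a_def by (rule continuous_on_compose2[OF concave_modulus_continuous[OF \<alpha>]])
      (auto intro!: continuous_intros)
  then have [measurable]: "a \<in> borel_measurable borel" by (rule borel_measurable_continuous_onI)
  \<comment> \<open>Since \<open>x - y = x * \<alpha> x\<close>, the number \<open>x\<close> is the
    area of a rectangle of height \<open>1 / \<alpha> x\<close> over \<open>{y<..x}\<close>, which
    lies below the graph of \<open>1 / \<alpha>\<close>.\<close>
  have "ennreal x = ennreal (1 / \<alpha> x) * ennreal (x - y)"
    using pos y by (subst ennreal_mult[symmetric]) (auto simp: y_def field_simps)
  also have "\<dots> = (\<integral>\<^sup>+ t. ennreal (1 / \<alpha> x) * indicator {y<..x} t \<partial>lborel)"
    using y by (subst nn_integral_cmult_indicator) auto
  also have "\<dots> \<le> (\<integral>\<^sup>+ t. ennreal (1 / a t) * indicator {y<..x} t \<partial>lborel)"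
  proof (rule nn_integral_mono)
    fix t
    have "1 / \<alpha> x \<le> 1 / \<alpha> t" if "y < t" "t \<le> x"
      using that y by (intro divide_left_mono concave_modulus_mono[OF \<alpha>] mult_pos_pos
          concave_modulus_pos[OF \<alpha>]) auto
    then show "ennreal (1 / \<alpha> x) * indicator {y<..x} t \<le> ennreal (1 / a t) * indicator {y<..x} t"
      using y by (auto simp: a_def indicator_def intro!: ennreal_leI)
  qed
  finally have "ennreal x + (\<integral>\<^sup>+ t. ennreal (1 / a t) * indicator {0..y} t \<partial>lborel)
     \<le> (\<integral>\<^sup>+ t. ennreal (1 / a t) * indicator {y<..x} t \<partial>lborel)
      + (\<integral>\<^sup>+ t. ennreal (1 / a t) * indicator {0..y} t \<partial>lborel)"
    by (rule add_right_mono)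
  also have "\<dots> = (\<integral>\<^sup>+ t. ennreal (1 / a t) * indicator {y<..x} t
      + ennreal (1 / a t) * indicator {0..y} t \<partial>lborel)"
    by (rule nn_integral_add[symmetric]) measurable
  also have "\<dots> = (\<integral>\<^sup>+ t. ennreal (1 / a t) * indicator {0..x} t \<partial>lborel)"
    using y by (intro nn_integral_cong) (auto simp: indicator_def)
  finally have *: "ennreal x + (\<integral>\<^sup>+ t. ennreal (1 / a t) * indicator {0..y} t \<partial>lborel)
      \<le> (\<integral>\<^sup>+ t. ennreal (1 / a t) * indicator {0..x} t \<partial>lborel)" .
  have "(\<integral>\<^sup>+ t. ennreal (1 / a t) * indicator {0..z} t \<partial>lborel)
     = (\<integral>\<^sup>+ t\<in>{0..z}. ennreal (1 / \<alpha> t) \<partial>lborel)" for z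
    by (intro nn_integral_cong) (auto simp: indicator_def a_def max_def)
  with * show ?thesis by (simp add: y_def)
qed

section \<open>Gap lengths from the recursion and their summability\<close>

fun gap_length :: "(real \<Rightarrow> real) \<Rightarrow> real \<Rightarrow> nat \<Rightarrow> real" where
  "gap_length \<alpha> x 0 = x"
| "gap_length \<alpha> x (Suc k) = gap_length \<alpha> x k * (1 - \<alpha> (gap_length \<alpha> x k))"

lemma gap_length_props:
  assumes \<alpha>: "concave_modulus \<alpha>" and x: "0 < x" "\<alpha> x < 1"
  shows "0 < gap_length \<alpha> x k \<and> gap_length \<alpha> x k \<le> x \<and> \<alpha> (gap_length \<alpha> x k) \<le> \<alpha> x"
proof (induction k)
  case (Suc k)
  let ?u = "gap_length \<alpha> x k"
  have p: "\<alpha> ?u > 0" using Suc by (intro concave_modulus_pos[OF \<alpha>]) auto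
  have "0 < ?u * (1 - \<alpha> ?u)" using Suc x by auto
  moreover have "?u * (1 - \<alpha> ?u) \<le> ?u" using p Suc by (simp add: algebra_simps)
  moreover from calculation have "\<alpha> (?u * (1 - \<alpha> ?u)) \<le> \<alpha> ?u"
    by (intro concave_modulus_mono[OF \<alpha>]) auto
  ultimately show ?case using Suc by (simp only: gap_length.simps) argo
qed (use x in auto)

lemma gap_length_summable:
  assumes \<alpha>: "concave_modulus \<alpha>" and x: "0 < x" "x \<le> 1" "\<alpha> x < 1"
    and fin: "(\<integral>\<^sup>+ x\<in>{0..1}. ennreal (1 / \<alpha> x) \<partial>lborel) < \<infinity>"
  shows "summable (gap_length \<alpha> x)"
proof -
  let ?u = "gap_length \<alpha> x"
  define I where "I z = (\<integral>\<^sup>+ t\<in>{0..z}. ennreal (1 / \<alpha> t) \<partial>lborel)" for z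
  note p = gap_length_props[OF \<alpha> x(1,3)]
  have step: "ennreal (?u k) + I (?u (Suc k)) \<le> I (?u k)" for k
    using nn_integral_inverse_modulus_step[OF \<alpha>, of "?u k"] p[of k] x by (auto simp: I_def)
  \<comment> \<open>Carrying along the part of the integral not yet consumed makes the step
    inequality telescope.\<close>
  have "ennreal (\<Sum>k<n. ?u k) + I (?u n) \<le> I x" for n
  proof (induction n)
    case (Suc n)
    have "ennreal (\<Sum>k<Suc n. ?u k) + I (?u (Suc n))
        = ennreal (\<Sum>k<n. ?u k) + (ennreal (?u n) + I (?u (Suc n)))"
      using p by (simp add: ennreal_plus sum_nonneg less_imp_le add.assoc del: gap_length.simps)
    also have "\<dots> \<le> ennreal (\<Sum>k<n. ?u k) + I (?u n)"
      by (intro add_left_mono step)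
    finally show ?case using Suc by simp
  qed simp
  moreover have "I x \<le> I 1"
    unfolding I_def using x by (intro nn_integral_mono) (auto simp: indicator_def)
  ultimately have le: "ennreal (\<Sum>k<n. ?u k) \<le> I 1" for n
    by (meson le_iff_add order_trans)
  obtain r where r: "I 1 = ennreal r" "r \<ge> 0"
    using fin by (cases "I 1") (auto simp: I_def)
  have "(\<Sum>k<n. ?u k) \<le> r" for n using le[of n] r by simp
  then show ?thesis
    using p by (intro summableI_nonneg_bounded) (auto intro: less_imp_le)
qed

lemma exists_gap_lengths:
  fixes \<delta> :: real
  assumes \<alpha>: "concave_modulus \<alpha>" and \<delta>: "0 < \<delta>" "\<delta> < 1"
    and fin: "(\<integral>\<^sup>+ x\<in>{0..1}. ennreal (1 / \<alpha> x) \<partial>lborel) < \<infinity>"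
  obtains u :: "nat \<Rightarrow> real" where "\<And>k. 0 < u k" "\<And>k. \<alpha> (u k) \<le> \<delta>"
    "\<And>k. u (Suc k) = u k * (1 - \<alpha> (u k))" "summable u" "suminf u < \<delta>"
proof -
  obtain x where x: "0 < x" "x \<le> 1" "\<alpha> x \<le> \<delta>" by (rule concave_modulus_small[OF \<alpha> \<delta>(1)])
  let ?v = "gap_length \<alpha> x"
  have s: "summable ?v" using x \<delta> by (intro gap_length_summable[OF \<alpha> _ _ _ fin]) auto
  from suminf_exist_split[OF \<delta>(1) s] obtain N where N: "norm (\<Sum>i. ?v (i + N)) < \<delta>"
    by auto
  have x1: "\<alpha> x < 1" using x \<delta> by simp
  note p = gap_length_props[OF \<alpha> x(1) x1]
  show ?thesis
  proof (rule that[of "\<lambda>k. ?v (k + N)"])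
    show "summable (\<lambda>k. ?v (k + N))" using s by (simp only: summable_iff_shift)
    show "0 < ?v (k + N)" for k using p by simp
    show "\<alpha> (?v (k + N)) \<le> \<delta>" for k using p[of "k + N"] x by simp
    show "(\<Sum>k. ?v (k + N)) < \<delta>" using N by auto
    show "?v (Suc k + N) = ?v (k + N) * (1 - \<alpha> (?v (k + N)))" for k by simp
  qed
qed

lemma summable_abs_index:
  fixes u :: "nat \<Rightarrow> real"
  assumes "\<And>k. 0 \<le> u k" "summable u"
  shows "(\<lambda>n. u (nat \<bar>n\<bar>)) summable_on (UNIV :: int set)"
    and "infsum (\<lambda>n. u (nat \<bar>n\<bar>)) (UNIV :: int set) \<le> 2 * suminf u"
proof -
  have b: "(\<Sum>n\<in>X. u (nat \<bar>n\<bar>)) \<le> 2 * suminf u" if "finite X" for X :: "int set"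
  proof -
    \<comment> \<open>The absolute value is injective on nonnegative and on negative indices
      separately, whence the factor 2.\<close>
    have half: "(\<Sum>n\<in>Y. u (nat \<bar>n\<bar>)) \<le> suminf u" if "finite Y" "inj_on (\<lambda>n. nat \<bar>n\<bar>) Y" for Y :: "int set"
    proof -
      have "(\<Sum>n\<in>Y. u (nat \<bar>n\<bar>)) = sum u ((\<lambda>n. nat \<bar>n\<bar>) ` Y)"
        using that by (simp add: sum.reindex)
      also have "\<dots> \<le> suminf u" using assms that by (intro sum_le_suminf) auto
      finally show ?thesis .
    qed
    have "(\<Sum>n\<in>X. u (nat \<bar>n\<bar>)) = (\<Sum>n\<in>X \<inter> {0..}. u (nat \<bar>n\<bar>)) + (\<Sum>n\<in>X \<inter> {..<0}. u (nat \<bar>n\<bar>))"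
      using that by (subst sum.union_disjoint[symmetric]) (auto intro: sum.cong)
    also have "\<dots> \<le> suminf u + suminf u"
      using that by (intro add_mono half) (auto simp: inj_on_def)
    finally show ?thesis by simp
  qed
  show s: "(\<lambda>n. u (nat \<bar>n\<bar>)) summable_on (UNIV :: int set)"
    using assms b by (intro nonneg_bdd_above_summable_on) (auto intro!: bdd_aboveI2)
  show "infsum (\<lambda>n. u (nat \<bar>n\<bar>)) (UNIV :: int set) \<le> 2 * suminf u"
    by (rule infsum_le_finite_sums[OF s]) (use b in auto)
qed

section \<open>A periodic staircase\<close>

lemma has_real_derivative_pos_part_square:
  "((\<lambda>x::real. (max 0 x)\<^sup>2) has_real_derivative 2 * max 0 x) (at x)"
proof (cases "x = 0")
  case True
  have "((\<lambda>h::real. max 0 h) \<longlongrightarrow> max 0 0) (at 0)" by (intro tendsto_intros)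
  then have "((\<lambda>h::real. max 0 h) \<longlongrightarrow> 0) (at 0)" by simp
  then have "((\<lambda>h::real. (max 0 h)\<^sup>2 / h) \<longlongrightarrow> 0) (at 0)"
    by (rule Lim_transform_eventually)
      (auto simp: max_def power2_eq_square eventually_at_filter)
  then show ?thesis by (simp add: True DERIV_def)
next
  case False
  then consider "x > 0" | "x < 0" by linarith
  then show ?thesis
  proof cases
    case 1
    have "((\<lambda>x::real. x\<^sup>2) has_real_derivative 2 * x) (at x)"
      by (auto intro!: derivative_eq_intros)
    then have "((\<lambda>x::real. (max 0 x)\<^sup>2) has_real_derivative 2 * x) (at x)"
      by (rule has_field_derivative_transform_within_open[where S="{0<..}"]) (use 1 in auto)
    with 1 show ?thesis by simp
  next
    case 2
    have "((\<lambda>x::real. (max 0 x)\<^sup>2) has_real_derivative 0) (at x)"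
      by (rule has_field_derivative_transform_within_open[where S="{..<0}" and f="\<lambda>_. 0"])
        (use 2 in auto)
    with 2 show ?thesis by simp
  qed
qed

text \<open>The second antiderivative of a tent's slope jumps: a combination of squared positive
  parts whose derivative is the tent of height 2 and area 1 on \<open>[-1/2, 1/2]\<close>.\<close>

definition ramp :: "real \<Rightarrow> real" where
  "ramp s = 2 * ((max 0 (s + 1/2))\<^sup>2 - 2 * (max 0 s)\<^sup>2 + (max 0 (s - 1/2))\<^sup>2)"

lemma ramp_deriv: "(ramp has_real_derivative max 0 (2 - 4 * \<bar>s\<bar>)) (at s)"
proof -
  have sh: "((\<lambda>x::real. (max 0 (x + c))\<^sup>2) has_real_derivative 2 * max 0 (s + c)) (at s)" for c
    using DERIV_shift[of "\<lambda>x. (max 0 x)\<^sup>2" "2 * max 0 (s + c)" s c]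
      has_real_derivative_pos_part_square[of "s + c"] by simp
  have "(ramp has_real_derivative
     2 * (2 * max 0 (s + 1/2) - 2 * (2 * max 0 s) + 2 * max 0 (s + - (1/2)))) (at s)"
    unfolding ramp_def diff_conv_add_uminus[of _ "1/2::real"]
    by (intro DERIV_cmult DERIV_add DERIV_diff sh has_real_derivative_pos_part_square)
  moreover have "2 * (2 * max 0 (s + 1/2) - 2 * (2 * max 0 s) + 2 * max 0 (s + - (1/2)))
      = max 0 (2 - 4 * \<bar>s\<bar>)" by (auto simp: max_def abs_if)
  ultimately show ?thesis by simp
qed

lemma ramp_left: "s \<le> -1/2 \<Longrightarrow> ramp s = 0"
  by (auto simp: ramp_def max_def)

lemma ramp_right: "1/2 \<le> s \<Longrightarrow> ramp s = 1"
  by (auto simp: ramp_def max_def power2_eq_square algebra_simps)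

lemma ramp_bounds: "0 \<le> ramp s" "ramp s \<le> 1"
proof -
  have mono: "ramp s \<le> ramp t" if "s \<le> t" for s t
    by (rule DERIV_nonneg_imp_nondecreasing[OF that]) (use ramp_deriv in \<open>meson max.cobounded1\<close>)
  show "0 \<le> ramp s"
    using mono[of "min s (-1/2)" s] ramp_left[of "min s (-1/2)"] by simp
  show "ramp s \<le> 1"
    using mono[of s "max s (1/2)"] ramp_right[of "max s (1/2)"] by simp
qed

section \<open>The staircase and its periodic derivative\<close>

lemma dist_to_Ints_lipschitz: "\<bar>dist_to_Ints x - dist_to_Ints y\<bar> \<le> dist_to_Ints (x - y)"
  using dist_to_Ints_add_le[of "x - y" y] dist_to_Ints_add_le[of "y - x" x]
    dist_to_Ints_uminus[of "x - y"] by auto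

text \<open>
  \<open>step l\<close> is a \<open>C\<^sup>1\<close> function with \<open>step l (y + 1) = step l y + l\<close> that increases only on the
  intervals of length \<open>l\<close> centred at the integers.
\<close>

definition step :: "real \<Rightarrow> real \<Rightarrow> real" where
  "step l y = l * (of_int (round y) + ramp ((y - of_int (round y)) / l))"

text \<open>The derivative of \<open>step l\<close>. Height 2 over width \<open>l\<close> gives each
  tent area \<open>l\<close>, the rise of one stair.\<close>

definition hat :: "real \<Rightarrow> real \<Rightarrow> real" where
  "hat l y = max 0 (2 - 4 * (dist_to_Ints y / l))"

text \<open>Switching the nearest integer at a half-integer does no harm: between two bumps the ramp
  at the left integer is already 1 and the one at the right still 0. So a single formula holds up to
  the neighbouring bumps.\<close>

lemma step_local:
  assumes l: "0 < l" "l \<le> 1"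
    and y: "of_int k - 1 + l / 2 \<le> y" "y \<le> of_int k + 1 - l / 2"
  shows "step l y = l * (of_int k + ramp ((y - of_int k) / l))"
proof -
  have r: "of_int (round y) \<le> y + 1/2" "y + 1/2 < of_int (round y) + 1"
    unfolding round_def by linarith+
  have "of_int (k - 1) < (of_int (round y) + 1 :: real)" "of_int (round y) < (of_int (k + 2) :: real)"
    using r y l by auto
  then have "k - 1 < round y + 1" "round y < k + 2" by linarith+
  then consider "round y = k" | "round y = k + 1" | "round y = k - 1" by linarith
  then show ?thesis
  proof cases
    case 1
    then show ?thesis by (simp add: step_def)
  next
    case 2
    have "ramp ((y - of_int k) / l) = 1"
      using 2 r y l by (intro ramp_right) (auto simp: field_simps)
    moreover have "ramp ((y - of_int (k + 1)) / l) = 0"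
      using 2 r y l by (intro ramp_left) (auto simp: field_simps)
    ultimately show ?thesis by (simp add: step_def 2)
  next
    case 3
    have "ramp ((y - of_int k) / l) = 0"
      using 3 r y l by (intro ramp_left) (auto simp: field_simps)
    moreover have "ramp ((y - of_int (k - 1)) / l) = 1"
      using 3 r y l by (intro ramp_right) (auto simp: field_simps)
    ultimately show ?thesis by (simp add: step_def 3)
  qed
qed

lemma step_flat:
  assumes "0 < l" "l \<le> 1" "of_int k + l / 2 \<le> y" "y \<le> of_int k + 1 - l / 2"
  shows "step l y = l * (of_int k + 1)"
proof -
  have "ramp ((y - of_int k) / l) = 1"
    using assms by (intro ramp_right) (auto simp: field_simps)
  then show ?thesis using assms step_local[of l k y] by simp
qed

lemma step_plus_1: "step l (y + 1) = step l y + l"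
proof -
  have "round (y + 1) = round y + 1"
    using floor_add_int[of "y + 1/2" 1] by (simp add: round_def add.commute add.left_commute)
  then show ?thesis by (simp add: step_def algebra_simps)
qed

lemma step_bound:
  assumes "0 < l"
  shows "\<bar>step l y\<bar> \<le> l * (\<bar>y\<bar> + 2)"
proof -
  have r: "of_int (round y) \<le> y + 1/2" "y + 1/2 < of_int (round y) + 1"
    unfolding round_def by linarith+
  have "\<bar>of_int (round y) + ramp ((y - of_int (round y)) / l)\<bar> \<le> \<bar>y\<bar> + 2"
    using r ramp_bounds[of "(y - of_int (round y)) / l"] by linarith
  then show ?thesis using assms by (simp add: step_def abs_mult)
qed

lemma step_deriv:
  assumes l: "0 < l" "l < 1"
  shows "(step l has_real_derivative hat l y) (at y)"
proof -
  define k where "k = round y"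
  have r: "of_int k \<le> y + 1/2" "y + 1/2 < of_int k + 1"
    unfolding round_def k_def by linarith+
  \<comment> \<open>\<open>y\<close> is within 1/2 of \<open>k\<close>, so \<open>l < 1\<close> puts
    it strictly inside the region of the local formula.\<close>
  let ?S = "{of_int k - 1 + l / 2<..<of_int k + 1 - l / 2}"
  have "((\<lambda>y. l * (of_int k + ramp ((y - of_int k) / l))) has_real_derivative
     l * (max 0 (2 - 4 * \<bar>(y - of_int k) / l\<bar>) * (1 / l))) (at y)"
  proof -
    have "((\<lambda>y. (y - of_int k) / l) has_real_derivative 1 / l) (at y)"
      using l by (auto intro!: derivative_eq_intros)
    from DERIV_chain2[OF ramp_deriv this]
    have "((\<lambda>y. of_int k + ramp ((y - of_int k) / l)) has_real_derivative
        0 + max 0 (2 - 4 * \<bar>(y - of_int k) / l\<bar>) * (1 / l)) (at y)"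
      by (intro DERIV_add DERIV_const)
    from DERIV_cmult[OF this, of l] show ?thesis by simp
  qed
  moreover have "l * (max 0 (2 - 4 * \<bar>(y - of_int k) / l\<bar>) * (1 / l)) = hat l y"
    using l by (simp add: hat_def dist_to_Ints_def k_def)
  ultimately have "((\<lambda>y. l * (of_int k + ramp ((y - of_int k) / l))) has_real_derivative hat l y) (at y)"
    by simp
  then show ?thesis
    by (rule has_field_derivative_transform_within_open[where S="?S"])
      (use r l in \<open>auto intro!: step_local[symmetric]\<close>)
qed

lemma hat_bounds: "0 < l \<Longrightarrow> 0 \<le> hat l y" "0 < l \<Longrightarrow> hat l y \<le> 2"
  by (auto simp: hat_def dist_to_Ints_def)

text \<open>Combines slope \<open>4 / l\<close> with the trivial bound by the height, in the form
  needed for \<open>concave_modulus_min\<close>.\<close>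

lemma hat_lipschitz:
  assumes "0 < l"
  shows "\<bar>hat l x - hat l y\<bar> \<le> 4 * min 1 (dist_to_Ints (x - y) / l)"
proof -
  have "\<bar>dist_to_Ints x / l - dist_to_Ints y / l\<bar> \<le> dist_to_Ints (x - y) / l"
    using dist_to_Ints_lipschitz[of x y] assms
    by (simp add: diff_divide_distrib[symmetric] divide_right_mono)
  then have "\<bar>hat l x - hat l y\<bar> \<le> 4 * (dist_to_Ints (x - y) / l)"
    by (auto simp: hat_def)
  moreover have "\<bar>hat l x - hat l y\<bar> \<le> 4"
    using hat_bounds[OF assms, of x] hat_bounds[OF assms, of y] by auto
  ultimately show ?thesis by simp
qed

lemma hat_posD:
  assumes "0 < l" "hat l y \<noteq> 0"
  obtains k :: int where "of_int k - l / 2 < y" "y < of_int k + l / 2"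
proof -
  have "\<bar>y - of_int (round y)\<bar> < l / 2"
    using assms by (auto simp: hat_def dist_to_Ints_def max_def field_simps split: if_splits)
  then show ?thesis by (intro that[of "round y"]) (simp_all only: abs_less_iff, argo+)
qed

section \<open>The Denjoy map on the line\<close>

lemma summable_on_diff:
  fixes f g :: "'a \<Rightarrow> real"
  assumes "f summable_on A" "g summable_on A"
  shows "(\<lambda>x. f x - g x) summable_on A"
  using summable_on_add[OF assms(1) summable_on_uminus[THEN iffD2, OF assms(2)]] by simp

lemma infsum_diff:
  fixes f g :: "'a \<Rightarrow> real"
  assumes "f summable_on A" "g summable_on A"
  shows "infsum (\<lambda>x. f x - g x) A = infsum f A - infsum g A"
  using infsum_add[OF assms(1) summable_on_uminus[THEN iffD2, OF assms(2)]] by (simp add: infsum_uminus)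

text \<open>Total length below 1 leaves positive measure outside the gaps. As tents have height 2,
  \<open>amp_bound\<close> keeps the derivative at least 1/2; \<open>amp_vanish\<close> yields
  uniform convergence of the derivatives.\<close>

locale denjoy_lengths =
  fixes \<theta> :: real and l :: "int \<Rightarrow> real"
  assumes irrational: "\<theta> \<notin> \<rat>"
    and l_pos: "0 < l n"
    and l_summable: "l summable_on UNIV"
    and l_total: "infsum l UNIV < 1"
    and amp_bound: "\<bar>l (n + 1) / l n - 1\<bar> \<le> 1/4"
    and amp_vanish: "0 < e \<Longrightarrow> finite {n. e \<le> \<bar>l (n + 1) / l n - 1\<bar>}"
begin

section \<open>The orbit of 0, sums over the integers, and the blow-up\<close>

definition L :: real where "L = infsum l UNIV"

definition amp :: "int \<Rightarrow> real" where "amp n = l (n + 1) / l n - 1"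

definition a :: "int \<Rightarrow> real" where "a n = frac (of_int n * \<theta>)"

lemma a_bounds: "0 \<le> a n" "a n < 1"
  by (simp_all add: a_def frac_lt_1)

text \<open>Orbit points are distinct modulo 1 by irrationality; this is what makes different gaps
  disjoint.\<close>

lemma a_inj:
  assumes "a n - a m \<in> \<int>"
  shows "n = m"
proof (rule ccontr)
  assume "n \<noteq> m"
  have "of_int n * \<theta> - of_int m * \<theta> = (a n - a m) + of_int (\<lfloor>of_int n * \<theta>\<rfloor> - \<lfloor>of_int m * \<theta>\<rfloor>)"
    by (simp add: a_def frac_def)
  also have "\<dots> \<in> \<int>" using assms by (intro Ints_add) auto
  finally obtain k where k: "of_int n * \<theta> - of_int m * \<theta> = of_int k" by (rule Ints_cases)
  then have "\<theta> = of_int k / of_int (n - m)" using \<open>n \<noteq> m\<close> by (simp add: field_simps)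
  then show False using irrational by (metis Rats_divide Rats_of_int)
qed

lemma l_le_L: "l n \<le> L"
  using finite_sum_le_infsum[OF l_summable, of "{n}"] l_pos by (auto simp: L_def less_imp_le)

lemma L_bounds: "0 < L" "L < 1"
  using l_le_L[of 0] l_pos[of 0] l_total by (auto simp: L_def)

lemma l_less_1: "l n < 1"
  using l_le_L[of n] L_bounds by simp

lemma summable_l_bounded:
  assumes "\<And>n. \<bar>c n\<bar> \<le> C"
  shows "(\<lambda>n. l n * c n) summable_on UNIV"
proof -
  have "(\<lambda>n. l n * C) summable_on UNIV" by (intro summable_on_cmult_left l_summable)
  then have "(\<lambda>n. norm (l n * c n)) summable_on UNIV"
    by (rule Infinite_Sum.abs_summable_on_comparison_test')
      (simp add: abs_mult abs_of_pos[OF l_pos] mult_left_mono[OF assms less_imp_le[OF l_pos]])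
  then show ?thesis by (rule summable_on_iff_abs_summable_on_real[THEN iffD2])
qed

lemma bij_shift: "bij_betw (\<lambda>n::int. n + 1) UNIV UNIV"
  by (rule bij_betwI[where g="\<lambda>n. n - 1"]) auto

lemma shift_infsum: "infsum (\<lambda>n. f (n + 1)) (UNIV :: int set) = infsum f UNIV"
  by (rule infsum_reindex_bij_betw[OF bij_shift])

lemma shift_summable: "(\<lambda>n. f (n + 1)) summable_on (UNIV :: int set) \<longleftrightarrow> f summable_on UNIV"
  by (rule summable_on_reindex_bij_betw[OF bij_shift])

text \<open>
  \<open>J\<close> blows up the circle along the orbit of 0 under the rotation: it jumps by \<open>l n\<close> at the points
  of \<open>n \<theta> + \<int>\<close>, so the gap inserted there is \<open>{J t - l n..J t}\<close>. Using \<open>frac (n \<theta>)\<close> instead of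
  \<open>n \<theta>\<close> makes the sum converge, since \<open>n l n\<close> need not be summable.
\<close>

definition J :: "real \<Rightarrow> real" where
  "J t = (1 - L) * t + infsum (\<lambda>n. l n * of_int \<lfloor>t - a n\<rfloor>) UNIV"

lemma floor_a_bound: "\<bar>of_int \<lfloor>t - a n\<rfloor> :: real\<bar> \<le> \<bar>t\<bar> + 2"
  using a_bounds[of n] by linarith

lemma J_summable: "(\<lambda>n. l n * of_int \<lfloor>t - a n\<rfloor>) summable_on UNIV"
  by (rule summable_l_bounded[OF floor_a_bound])

text \<open>The slope \<open>1 - L\<close> and the jumps, of total size \<open>L\<close> per period,
  add up to 1.\<close>

lemma J_add_int: "J (t + of_int k) = J t + of_int k"
proof -
  have "infsum (\<lambda>n. l n * of_int \<lfloor>t + of_int k - a n\<rfloor>) UNIV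
      = infsum (\<lambda>n. l n * of_int \<lfloor>t - a n\<rfloor> + l n * of_int k) UNIV"
  proof (rule infsum_cong)
    fix n
    have "\<lfloor>t + of_int k - a n\<rfloor> = \<lfloor>t - a n\<rfloor> + k"
      by (metis add_diff_eq diff_add_eq floor_add_int)
    then show "l n * of_int \<lfloor>t + of_int k - a n\<rfloor> = l n * of_int \<lfloor>t - a n\<rfloor> + l n * of_int k"
      by (simp add: distrib_left)
  qed
  also have "\<dots> = infsum (\<lambda>n. l n * of_int \<lfloor>t - a n\<rfloor>) UNIV + L * of_int k"
    by (subst infsum_add)
      (auto intro!: J_summable summable_on_cmult_left l_summable simp: infsum_cmult_left' L_def)
  finally show ?thesis by (simp add: J_def algebra_simps)
qed

lemma J_diff_ge:
  assumes "s \<le> t"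
  shows "l n * (of_int \<lfloor>t - a n\<rfloor> - of_int \<lfloor>s - a n\<rfloor>) \<le> J t - J s"
proof -
  let ?d = "\<lambda>m. l m * of_int \<lfloor>t - a m\<rfloor> - l m * of_int \<lfloor>s - a m\<rfloor>"
  have "?d m \<ge> 0" for m
    using assms l_pos[of m] by (auto intro!: mult_left_mono floor_mono)
  then have "sum ?d {n} \<le> infsum ?d UNIV"
    by (intro finite_sum_le_infsum summable_on_diff J_summable) auto
  also have "\<dots> = infsum (\<lambda>n. l n * of_int \<lfloor>t - a n\<rfloor>) UNIV - infsum (\<lambda>n. l n * of_int \<lfloor>s - a n\<rfloor>) UNIV"
    by (intro infsum_diff J_summable)
  also have "\<dots> \<le> J t - J s"
    using assms L_bounds mult_left_mono[of s t "1 - L"] by (simp add: J_def)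
  finally show ?thesis by (simp add: right_diff_distrib)
qed

lemma J_mono: "s \<le> t \<Longrightarrow> J s \<le> J t"
proof -
  assume st: "s \<le> t"
  then have "0 \<le> l 0 * (of_int \<lfloor>t - a 0\<rfloor> - of_int \<lfloor>s - a 0\<rfloor>)"
    using l_pos[of 0] by (auto intro!: mult_nonneg_nonneg floor_mono)
  with J_diff_ge[OF st, of 0] show ?thesis by linarith
qed

text \<open>The floor in the \<open>n\<close>-th term rises by at least 1 on reaching
  \<open>t\<close>. This inequality separates the gaps from each other.\<close>

lemma J_jump:
  assumes "s < t" "t - a n \<in> \<int>"
  shows "J s + l n \<le> J t"
proof -
  from assms(2) obtain k where k: "t - a n = of_int k" by (rule Ints_cases)
  have "\<lfloor>s - a n\<rfloor> < k" using k assms(1) by linarith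
  then have "\<lfloor>s - a n\<rfloor> + 1 \<le> \<lfloor>t - a n\<rfloor>" by (simp add: k)
  then have "(1::real) \<le> of_int \<lfloor>t - a n\<rfloor> - of_int \<lfloor>s - a n\<rfloor>" by linarith
  then have "l n * 1 \<le> l n * (of_int \<lfloor>t - a n\<rfloor> - of_int \<lfloor>s - a n\<rfloor>)"
    using l_pos[of n] by (intro mult_left_mono) auto
  with J_diff_ge[of s t n] assms(1) show ?thesis by linarith
qed

text \<open>Each floor increment is at most \<open>\<bar>d\<bar> + 1\<close> in size, and the slope
  contributes the remaining \<open>L * \<bar>d\<bar>\<close>. Applied to \<open>d = \<theta>\<close>
  for closeness to the rotation.\<close>

lemma J_increment: "\<bar>J (t + d) - J t - d\<bar> \<le> L * (2 * \<bar>d\<bar> + 1)"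
proof -
  let ?d = "\<lambda>m. l m * of_int \<lfloor>t + d - a m\<rfloor> - l m * of_int \<lfloor>t - a m\<rfloor>"
  have s: "?d summable_on UNIV" by (intro summable_on_diff J_summable)
  have b: "\<bar>of_int \<lfloor>t + d - a m\<rfloor> - of_int \<lfloor>t - a m\<rfloor> :: real\<bar> \<le> \<bar>d\<bar> + 1" for m by linarith
  then have b': "\<bar>?d m\<bar> \<le> l m * (\<bar>d\<bar> + 1)" for m
    using mult_left_mono[OF b[of m] less_imp_le[OF l_pos[of m]]] l_pos[of m]
    by (simp add: right_diff_distrib[symmetric] abs_mult)
  have s': "(\<lambda>m. l m * c) summable_on UNIV" for c by (intro summable_on_cmult_left l_summable)
  have i: "infsum (\<lambda>m. l m * c) UNIV = L * c" for c by (simp add: infsum_cmult_left' L_def)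
  have "infsum ?d UNIV \<le> L * (\<bar>d\<bar> + 1)"
    unfolding i[symmetric] using b' by (intro infsum_mono s s') (simp add: abs_le_iff)
  moreover have "L * (- (\<bar>d\<bar> + 1)) \<le> infsum ?d UNIV"
    unfolding i[symmetric] using b' by (intro infsum_mono s s') (metis abs_le_iff minus_le_iff mult_minus_right)
  moreover have "J (t + d) - J t = (1 - L) * d + infsum ?d UNIV"
    using infsum_diff[OF J_summable[of "t + d"] J_summable[of t]] by (simp add: J_def algebra_simps)
  moreover have "\<bar>L * d\<bar> \<le> L * \<bar>d\<bar>" using L_bounds by (simp add: abs_mult)
  ultimately show ?thesis by (simp add: algebra_simps)
qed

text \<open>The floors already count the jump at \<open>a n\<close>, so \<open>J (a n)\<close> is
  the right end of the gap and \<open>mid n\<close> its centre.\<close>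

definition mid :: "int \<Rightarrow> real" where "mid n = J (a n) - l n / 2"

lemma J_lattice: "t = a n + of_int k \<Longrightarrow> J t = mid n + l n / 2 + of_int k"
  by (simp add: J_add_int mid_def)

text \<open>Such an \<open>x\<close> lies to the right of the \<open>n\<close>-th gap at
  \<open>q\<close> and, by \<open>J_jump\<close>, to the left of its next translate, where the
  staircase is flat.\<close>

lemma step_J_aux:
  assumes "a n + of_int q \<le> t" "t < a n + of_int q + 1" "J (a n) + of_int q \<le> x" "x \<le> J t"
  shows "step (l n) (x - mid n) = l n * (of_int q + 1)"
proof (rule step_flat)
  show "0 < l n" "l n \<le> 1" using l_pos l_less_1[of n] by auto
  show "of_int q + l n / 2 \<le> x - mid n" using assms(3) by (simp add: mid_def)
  have "J t + l n \<le> J (a n + of_int (q + 1))"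
    using assms(2) by (intro J_jump) auto
  then show "x - mid n \<le> of_int q + 1 - l n / 2"
    using assms(4) by (simp only: J_add_int) (simp add: mid_def)
qed

text \<open>On the image of \<open>J\<close> the staircase recovers the floor term of
  \<open>J\<close>; this is the key to \<open>F_J\<close>.\<close>

lemma step_J: "step (l n) (J t - mid n) = l n * (of_int \<lfloor>t - a n\<rfloor> + 1)"
proof (rule step_J_aux[where t=t])
  let ?q = "\<lfloor>t - a n\<rfloor>"
  show *: "a n + of_int ?q \<le> t" "t < a n + of_int ?q + 1" by linarith+
  show "J (a n) + of_int ?q \<le> J t" using J_mono[OF *(1)] by (simp add: J_add_int)
qed simp

text \<open>Crossing the \<open>m\<close>-th gap stays on one stair of any other index: by
  \<open>a_inj\<close> the last point of class \<open>a n\<close> is strictly before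
  \<open>t\<close>, so \<open>J_jump\<close> applies.\<close>

lemma step_J_left_other:
  assumes "t - a m \<in> \<int>" "n \<noteq> m"
  shows "step (l n) (J t - l m - mid n) = l n * (of_int \<lfloor>t - a n\<rfloor> + 1)"
proof (rule step_J_aux[where t=t])
  let ?q = "\<lfloor>t - a n\<rfloor>"
  show *: "a n + of_int ?q \<le> t" "t < a n + of_int ?q + 1" by linarith+
  have "a n + of_int ?q \<noteq> t"
  proof
    assume eq: "a n + of_int ?q = t"
    have "(t - a m) - of_int ?q \<in> \<int>" by (rule Ints_diff[OF assms(1) Ints_of_int])
    then have "a n - a m \<in> \<int>" by (subst (asm) eq[symmetric]) simp
    then show False using a_inj assms(2) by blast
  qed
  with * have "a n + of_int ?q < t" by simp
  from J_jump[OF this assms(1)]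
  show "J (a n) + of_int ?q \<le> J t - l m" by (simp add: J_add_int)
qed (use l_pos[of m] in simp)

text \<open>The left end of the gap lies on the previous stair, one jump \<open>l n\<close> below
  the value at \<open>J t\<close>.\<close>

lemma step_J_left_same:
  assumes "t - a n \<in> \<int>"
  shows "step (l n) (J t - l n - mid n) = l n * of_int \<lfloor>t - a n\<rfloor>"
proof -
  from assms obtain k where k: "t - a n = of_int k" by (rule Ints_cases)
  then have "J t = mid n + l n / 2 + of_int k" by (intro J_lattice) simp
  then have "step (l n) (J t - l n - mid n) = l n * (of_int (k - 1) + 1)"
    using l_pos[of n] l_less_1[of n] by (intro step_flat) auto
  then show ?thesis by (simp add: k)
qed

text \<open>Each tent lives inside a gap ending at some \<open>J (a n + k)\<close>, and
  \<open>J_jump\<close> puts the whole gap with the later endpoint to the right of the other;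
  \<open>a_inj\<close> excludes equal endpoints.\<close>

lemma hat_disjoint:
  assumes "hat (l n) (x - mid n) \<noteq> 0" "hat (l m) (x - mid m) \<noteq> 0"
  shows "n = m"
proof (rule ccontr)
  assume ne: "n \<noteq> m"
  from hat_posD[OF l_pos assms(1)] obtain p :: int
    where p: "of_int p - l n / 2 < x - mid n" "x - mid n < of_int p + l n / 2" .
  from hat_posD[OF l_pos assms(2)] obtain q :: int
    where q: "of_int q - l m / 2 < x - mid m" "x - mid m < of_int q + l m / 2" .
  have Jp: "J (a n + of_int p) = mid n + l n / 2 + of_int p"
    and Jq: "J (a m + of_int q) = mid m + l m / 2 + of_int q"
    by (rule J_lattice; simp)+
  consider "a n + of_int p < a m + of_int q" | "a m + of_int q < a n + of_int p"
    | "a n + of_int p = a m + of_int q" by linarith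
  then show False
  proof cases
    case 1
    then have "J (a n + of_int p) + l m \<le> J (a m + of_int q)" by (rule J_jump) simp
    then show False using p q unfolding Jp Jq by linarith
  next
    case 2
    then have "J (a m + of_int q) + l n \<le> J (a n + of_int p)" by (rule J_jump) simp
    then show False using p q unfolding Jp Jq by linarith
  next
    case 3
    then have "a n - a m = of_int (q - p)" by simp
    then have "a n - a m \<in> \<int>" by (metis Ints_of_int)
    then show False using ne a_inj by blast
  qed
qed

section \<open>The derivative of the Denjoy map\<close>

definition g :: "real \<Rightarrow> real" where
  "g x = 1 + infsum (\<lambda>n. amp n * hat (l n) (x - mid n)) UNIV"

text \<open>Disjoint supports reduce the series to at most one term; the estimates of
  \<open>g\<close> below rest on this split.\<close>

lemma g_cases:
  obtains "\<And>n. hat (l n) (x - mid n) = 0" "g x = 1"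
  | n where "hat (l n) (x - mid n) \<noteq> 0" "\<And>m. m \<noteq> n \<Longrightarrow> hat (l m) (x - mid m) = 0"
      "g x = 1 + amp n * hat (l n) (x - mid n)"
proof (cases "\<exists>n. hat (l n) (x - mid n) \<noteq> 0")
  case True
  then obtain n where n: "hat (l n) (x - mid n) \<noteq> 0" by blast
  then have z: "hat (l m) (x - mid m) = 0" if "m \<noteq> n" for m
    using hat_disjoint that by blast
  have "((\<lambda>n. amp n * hat (l n) (x - mid n)) has_sum (amp n * hat (l n) (x - mid n))) UNIV"
    by (rule has_sum_finite_neutralI[of "{n}"]) (use z in auto)
  then show ?thesis using n z by (intro that(2)[of n]) (auto simp: g_def dest: infsumI)
next
  case False
  then show ?thesis by (intro that(1)) (auto simp: g_def)
qed

lemma g_bound: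
  assumes "\<And>n. \<bar>amp n\<bar> \<le> \<delta>"
  shows "\<bar>g x - 1\<bar> \<le> 2 * \<delta>"
proof (cases x rule: g_cases)
  case 1
  then show ?thesis using order.trans[OF abs_ge_zero assms] by simp
next
  case (2 n)
  have "\<bar>amp n\<bar> * hat (l n) (x - mid n) \<le> \<delta> * 2"
    using assms[of n] hat_bounds[OF l_pos, of n "x - mid n"] by (intro mult_mono) auto
  then show ?thesis using 2 hat_bounds[OF l_pos, of n "x - mid n"] by (simp add: abs_mult)
qed

lemma g_pos: "0 < g x"
proof -
  have "\<bar>g x - 1\<bar> \<le> 2 * (1/4)" by (rule g_bound) (unfold amp_def, rule amp_bound)
  then show ?thesis by linarith
qed

text \<open>At most two terms matter, one for the gap of \<open>x\<close> and one for that of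
  \<open>y\<close>. If the gaps have different indices, each term vanishes at the other point and so
  is itself a difference.\<close>

lemma g_diff:
  assumes "\<And>n. \<bar>amp n\<bar> * \<bar>hat (l n) (x - mid n) - hat (l n) (y - mid n)\<bar> \<le> C"
  shows "\<bar>g x - g y\<bar> \<le> 2 * C"
proof -
  let ?b = "\<lambda>n x. amp n * hat (l n) (x - mid n)"
  have b: "\<bar>?b n x - ?b n y\<bar> \<le> C" for n
    using assms[of n] by (simp add: right_diff_distrib[symmetric] abs_mult)
  have C: "C \<ge> 0" using b[of 0] by linarith
  show ?thesis
  proof (cases x rule: g_cases)
    case 1
    note x = this
    show ?thesis
    proof (cases y rule: g_cases)
      case 1
      with x C show ?thesis by simp
    next
      case (2 m)
      with x b[of m] C show ?thesis by simp
    qed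
  next
    case (2 n)
    note x = this
    show ?thesis
    proof (cases y rule: g_cases)
      case 1
      with x b[of n] C show ?thesis by simp
    next
      case (2 m)
      show ?thesis
      proof (cases "n = m")
        case True
        with x 2 b[of n] C show ?thesis by simp
      next
        case False
        with x 2 b[of n] b[of m] show ?thesis by simp
      qed
    qed
  qed
qed

text \<open>The constant that makes \<open>F \<circ> J = J \<circ> (\<lambda>t. t + \<theta>)\<close> hold exactly.\<close>

definition c :: real where
  "c = (1 - L) * \<theta> + infsum (\<lambda>n. l (n + 1) * of_int (\<lfloor>of_int (n + 1) * \<theta>\<rfloor> - \<lfloor>of_int n * \<theta>\<rfloor>)) UNIV"

definition F :: "real \<Rightarrow> real" where
  "F x = c + x + infsum (\<lambda>n. amp n * step (l n) (x - mid n)) UNIV"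

section \<open>Action of the Denjoy map on the blown-up orbit and the gaps\<close>

lemma amp_l: "amp n * l n = l (n + 1) - l n"
  using l_pos[of n] by (simp add: amp_def field_simps)

lemma F_summable: "(\<lambda>n. amp n * step (l n) (x - mid n)) summable_on UNIV"
proof -
  \<comment> \<open>Choosing \<open>a n\<close> in \<open>[0, 1)\<close> bounds the centres
    uniformly in \<open>n\<close>, so every term is \<open>l n\<close> times a bounded
    factor.\<close>
  have mid: "\<bar>mid n\<bar> \<le> \<bar>J 0\<bar> + \<bar>J 1\<bar> + 1" for n
    using J_mono[of 0 "a n"] J_mono[of "a n" 1] a_bounds[of n] l_pos[of n] l_less_1[of n]
    unfolding mid_def by linarith
  have "\<bar>amp n * (step (l n) (x - mid n) / l n)\<bar> \<le> 1/4 * (\<bar>x\<bar> + (\<bar>J 0\<bar> + \<bar>J 1\<bar> + 1) + 2)" for n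
  proof -
    have "\<bar>step (l n) (x - mid n) / l n\<bar> \<le> \<bar>x - mid n\<bar> + 2"
      using step_bound[OF l_pos, of n "x - mid n"] l_pos[of n] by (simp add: field_simps)
    also have "\<dots> \<le> \<bar>x\<bar> + (\<bar>J 0\<bar> + \<bar>J 1\<bar> + 1) + 2" using mid[of n] by linarith
    finally show ?thesis
      unfolding abs_mult using amp_bound[of n] by (intro mult_mono) (auto simp: amp_def)
  qed
  from summable_l_bounded[OF this]
  have "(\<lambda>n. l n * (amp n * (step (l n) (x - mid n) / l n))) summable_on UNIV" .
  moreover have "l n * (amp n * (step (l n) (x - mid n) / l n)) = amp n * step (l n) (x - mid n)" for n
    using l_pos[of n] by simp
  ultimately show ?thesis by simp
qed

text \<open>The gaps only exchange their lengths, so the total change over one period is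
  zero.\<close>

lemma l_shift_infsum: "infsum (\<lambda>n. l (n + 1) - l n) UNIV = 0"
  using infsum_diff[of "\<lambda>n. l (n + 1)" UNIV l] shift_summable[of l] shift_infsum[of l] l_summable
  by simp

lemma l_shift_summable: "(\<lambda>n. l (n + 1) - l n) summable_on UNIV"
  using shift_summable[of l] l_summable by (intro summable_on_diff) auto

lemma F_plus_1: "F (x + 1) = F x + 1"
proof -
  have "infsum (\<lambda>n. amp n * step (l n) (x + 1 - mid n)) UNIV
    = infsum (\<lambda>n. amp n * step (l n) (x - mid n) + (l (n + 1) - l n)) UNIV"
    by (rule infsum_cong, subst amp_l[symmetric])
      (metis (no_types, opaque_lifting) distrib_left step_plus_1 diff_add_eq)
  also have "\<dots> = infsum (\<lambda>n. amp n * step (l n) (x - mid n)) UNIV"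
    using infsum_add[OF F_summable l_shift_summable] l_shift_infsum by simp
  finally show ?thesis by (simp add: F_def)
qed

text \<open>By \<open>step_J\<close> the series replaces the weights \<open>l n\<close> of the floor
  terms by \<open>l (n + 1)\<close>. Reindexing gives \<open>J (t + \<theta>)\<close> up to integers
  coming from the fractional parts, which do not depend on \<open>t\<close> and are collected in
  \<open>c\<close>.\<close>

lemma F_J: "F (J t) = J (t + \<theta>)"
proof -
  let ?r = "\<lambda>n. of_int (\<lfloor>of_int (n + 1) * \<theta>\<rfloor> - \<lfloor>of_int n * \<theta>\<rfloor>) :: real"
  let ?fl = "\<lambda>n. of_int \<lfloor>t - a n\<rfloor> :: real"
  have fl: "of_int \<lfloor>t + \<theta> - a (n + 1)\<rfloor> = ?fl n + ?r n" for n
  proof -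
    have "t + \<theta> - a (n + 1) = (t - a n) + of_int (\<lfloor>of_int (n + 1) * \<theta>\<rfloor> - \<lfloor>of_int n * \<theta>\<rfloor>)"
      by (simp add: a_def frac_def algebra_simps)
    then have "\<lfloor>t + \<theta> - a (n + 1)\<rfloor> = \<lfloor>t - a n\<rfloor> + (\<lfloor>of_int (n + 1) * \<theta>\<rfloor> - \<lfloor>of_int n * \<theta>\<rfloor>)"
      by (metis floor_add_int)
    then show ?thesis by simp
  qed
  have s1: "(\<lambda>n. l n * ?fl n) summable_on UNIV" by (rule J_summable)
  have s2: "(\<lambda>n. l (n + 1) * of_int \<lfloor>t + \<theta> - a (n + 1)\<rfloor>) summable_on UNIV"
    using shift_summable[of "\<lambda>n. l n * of_int \<lfloor>t + \<theta> - a n\<rfloor>"] J_summable by blast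
  have s3: "(\<lambda>n. amp n * step (l n) (J t - mid n)) summable_on UNIV" by (rule F_summable)
  have s4: "(\<lambda>n. l (n + 1) * ?fl n) summable_on UNIV"
  proof -
    have "(\<lambda>n. l n * (of_int \<lfloor>t - a (n - 1)\<rfloor> :: real)) summable_on UNIV"
      by (rule summable_l_bounded[OF floor_a_bound])
    then show ?thesis using shift_summable[of "\<lambda>n. l n * (of_int \<lfloor>t - a (n - 1)\<rfloor> :: real)"] by simp
  qed
  have s5: "(\<lambda>n. l (n + 1) * ?r n) summable_on UNIV"
    using summable_on_diff[OF s2 s4] by (simp add: fl distrib_left)
  have "infsum (\<lambda>n. amp n * step (l n) (J t - mid n)) UNIV
    = infsum (\<lambda>n. (l (n + 1) * ?fl n - l n * ?fl n) + (l (n + 1) - l n)) UNIV"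
  proof (rule infsum_cong)
    fix n
    have "amp n * step (l n) (J t - mid n) = (amp n * l n) * (?fl n + 1)" by (simp add: step_J)
    also have "\<dots> = (l (n + 1) * ?fl n - l n * ?fl n) + (l (n + 1) - l n)"
      unfolding amp_l by (simp add: algebra_simps)
    finally show "amp n * step (l n) (J t - mid n) = \<dots>" .
  qed
  also have "\<dots> = infsum (\<lambda>n. l (n + 1) * ?fl n) UNIV - infsum (\<lambda>n. l n * ?fl n) UNIV"
    using infsum_add[OF summable_on_diff[OF s4 s1] l_shift_summable] infsum_diff[OF s4 s1]
      l_shift_infsum by simp
  finally have F: "F (J t) = c + (1 - L) * t + infsum (\<lambda>n. l (n + 1) * ?fl n) UNIV"
    by (simp add: F_def J_def)
  have "infsum (\<lambda>n. l n * of_int \<lfloor>t + \<theta> - a n\<rfloor>) UNIV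
      = infsum (\<lambda>n. l (n + 1) * of_int \<lfloor>t + \<theta> - a (n + 1)\<rfloor>) UNIV"
    by (rule shift_infsum[symmetric])
  also have "\<dots> = infsum (\<lambda>n. l (n + 1) * ?fl n + l (n + 1) * ?r n) UNIV"
    by (simp only: fl distrib_left)
  also have "\<dots> = infsum (\<lambda>n. l (n + 1) * ?fl n) UNIV + infsum (\<lambda>n. l (n + 1) * ?r n) UNIV"
    by (rule infsum_add[OF s4 s5])
  finally show ?thesis unfolding F by (simp add: J_def c_def algebra_simps)
qed

text \<open>Between the two ends of the \<open>m\<close>-th gap only the \<open>m\<close>-th
  staircase changes, by one full stair, so the image has length
  \<open>l m + amp m * l m\<close>.\<close>

lemma F_gap:
  assumes "t - a m \<in> \<int>"
  shows "F (J t - l m) = J (t + \<theta>) - l (m + 1)"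
proof -
  let ?d = "\<lambda>n. amp n * step (l n) (J t - mid n) - amp n * step (l n) (J t - l m - mid n)"
  have "(?d has_sum (amp m * l m)) UNIV"
    by (rule has_sum_finite_neutralI[of "{m}"])
      (auto simp: step_J step_J_left_other[OF assms] step_J_left_same[OF assms]
        right_diff_distrib[symmetric] simp del: diff_diff_eq)
  then have "infsum ?d UNIV = amp m * l m" by (rule infsumI)
  moreover have "F (J t) - F (J t - l m) = l m + infsum ?d UNIV"
    by (simp add: F_def infsum_diff[OF F_summable F_summable])
  ultimately show ?thesis using F_J[of t] amp_l[of m] by simp
qed

text \<open>
  The amplitudes need not be summable, but the bumps have disjoint supports and the amplitudes
  tend to 0, so the derivatives of the partial sums still converge uniformly.
\<close>

lemma F_deriv: "(F has_real_derivative g x) (at x)"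
proof -
  define P where "P N x = c + x + (\<Sum>n\<in>{-int N..int N}. amp n * step (l n) (x - mid n))" for N x
  define p where "p N x = 1 + (\<Sum>n\<in>{-int N..int N}. amp n * hat (l n) (x - mid n))" for N x
  have dP: "(P N has_real_derivative p N x) (at x)" for N x
  proof -
    have "((\<lambda>x. step (l n) (x - mid n)) has_real_derivative hat (l n) (x - mid n)) (at x)" for n
      using DERIV_shift[of "step (l n)" "hat (l n) (x - mid n)" x "- mid n"]
        step_deriv[OF l_pos l_less_1, of n "x - mid n"] by simp
    then show ?thesis unfolding P_def p_def
      by (auto intro!: derivative_eq_intros sum.cong)
  qed
  have lim: "(\<lambda>N. P N x) \<longlonglongrightarrow> F x" for x
  proof -
    \<comment> \<open>Symmetric intervals eventually contain every finite index set, so the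
      unordered sum is also the limit of these partial sums.\<close>
    have fl: "filterlim (\<lambda>N. {-int N..int N}) (finite_subsets_at_top UNIV) sequentially"
    proof (rule filterlim_finite_subsets_at_top[THEN iffD2], intro allI impI)
      fix X :: "int set" assume "finite X \<and> X \<subseteq> UNIV"
      then obtain M where M: "\<And>n. n \<in> X \<Longrightarrow> \<bar>n\<bar> \<le> M"
        using finite_int_iff_bounded_le by (auto simp: image_subset_iff)
      show "\<forall>\<^sub>F N in sequentially. finite {-int N..int N} \<and> X \<subseteq> {-int N..int N} \<and> {-int N..int N} \<subseteq> UNIV"
        by (rule eventually_sequentiallyI[of "nat M"]) (use M in fastforce)
    qed
    have "((\<lambda>n. amp n * step (l n) (x - mid n)) has_sum
        infsum (\<lambda>n. amp n * step (l n) (x - mid n)) UNIV) UNIV"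
      by (rule has_sum_infsum[OF F_summable])
    then have "(\<lambda>N. \<Sum>n\<in>{-int N..int N}. amp n * step (l n) (x - mid n))
        \<longlonglongrightarrow> infsum (\<lambda>n. amp n * step (l n) (x - mid n)) UNIV"
      unfolding has_sum_def by (rule filterlim_compose) (rule fl)
    then show ?thesis unfolding P_def F_def by (intro tendsto_intros)
  qed
  have unif: "\<forall>\<^sub>F N in sequentially. \<forall>x\<in>UNIV. \<forall>h. norm (p N x * h - g x * h) \<le> e * norm h" if "e > 0" for e
  proof -
    \<comment> \<open>All but finitely many amplitudes are below \<open>e / 2\<close>; a tent of
      height 2 then contributes at most \<open>e\<close>, and no two tents overlap.\<close>
    have "finite {n. e / 2 \<le> \<bar>amp n\<bar>}" using amp_vanish[of "e/2"] that by (simp add: amp_def)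
    then obtain M where M: "\<And>n. e / 2 \<le> \<bar>amp n\<bar> \<Longrightarrow> \<bar>n\<bar> \<le> M"
      using finite_int_iff_bounded_le by (auto simp: image_subset_iff)
    show ?thesis
    proof (rule eventually_sequentiallyI[of "nat M"], intro ballI allI)
      fix N x h assume N: "nat M \<le> N"
      have "\<bar>p N x - g x\<bar> \<le> e"
      proof (cases x rule: g_cases)
        case 1
        then show ?thesis using that by (simp add: p_def)
      next
        case (2 n)
        have "p N x = 1 + (if n \<in> {-int N..int N} then amp n * hat (l n) (x - mid n) else 0)"
        proof -
          have "(\<Sum>m\<in>{-int N..int N}. amp m * hat (l m) (x - mid m))
            = (\<Sum>m\<in>{-int N..int N}. if m = n then amp n * hat (l n) (x - mid n) else 0)"
            using 2 by (intro sum.cong) auto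
          then show ?thesis by (simp add: p_def)
        qed
        moreover have "\<bar>amp n * hat (l n) (x - mid n)\<bar> \<le> e" if "n \<notin> {-int N..int N}"
        proof -
          have "\<bar>amp n\<bar> \<le> e / 2" using M[of n] that N by fastforce
          then have "\<bar>amp n\<bar> * hat (l n) (x - mid n) \<le> e / 2 * 2"
            using hat_bounds[OF l_pos, of n "x - mid n"] by (intro mult_mono) auto
          then show ?thesis using hat_bounds[OF l_pos, of n "x - mid n"] by (simp add: abs_mult)
        qed
        ultimately show ?thesis using 2 that by auto
      qed
      then show "norm (p N x * h - g x * h) \<le> e * norm h"
        by (simp add: left_diff_distrib[symmetric] abs_mult mult_right_mono)
    qed
  qed
  have "\<exists>G. \<forall>x\<in>UNIV. (\<lambda>N. P N x) \<longlonglongrightarrow> G x \<and> (G has_derivative (\<lambda>h. g x * h)) (at x within UNIV)"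
    by (rule has_derivative_sequence[where f'="\<lambda>N x h. p N x * h", OF _ _ unif _ lim])
      (use dP in \<open>auto simp: has_field_derivative_def\<close>)
  then obtain G where G: "\<And>x. (\<lambda>N. P N x) \<longlonglongrightarrow> G x" "\<And>x. (G has_derivative (\<lambda>h. g x * h)) (at x)"
    by auto
  have "G = F" using LIMSEQ_unique[OF G(1) lim] by auto
  then show ?thesis using G(2)[of x] by (simp add: has_field_derivative_def)
qed

end

section \<open>Maps of the circle\<close>

lemma proj_rep_circle: "proj (rep_circle p) = p"
  by (rule Quotient3_abs_rep[OF Quotient3_circle])

lemma dist_to_Ints_le_abs: "dist_to_Ints t \<le> \<bar>t\<bar>"
  using dist_to_Ints_le[of t 0] by simp

lemma dist_to_Ints_nonneg: "0 \<le> dist_to_Ints t"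
  by (simp add: dist_to_Ints_def)

lemma continuous_on_proj: "continuous_on UNIV proj"
  unfolding continuous_on_iff
  by (metis dist_proj dist_to_Ints_le_abs dist_real_def le_less_trans)

text \<open>Translating by the nearest integer realises the circle distance on the line, so local
  questions can be lifted.\<close>

lemma circle_nearest_preimage:
  obtains y where "p = proj y" "\<bar>y - x\<bar> = dist p (proj x)"
proof -
  obtain z where z: "p = proj z" using proj_surj by blast
  define y where "y = z - of_int (round (z - x))"
  have "proj y = proj z" by (simp add: proj_eq_iff y_def)
  moreover have "\<bar>y - x\<bar> = dist_to_Ints (z - x)" by (simp add: y_def dist_to_Ints_def algebra_simps)
  ultimately show ?thesis using z that[of y] by (simp add: dist_proj)
qed

lemma continuous_on_circleI:
  fixes q :: "circle \<Rightarrow> 'b::metric_space"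
  assumes "continuous_on UNIV (\<lambda>x. q (proj x))"
  shows "continuous_on UNIV q"
  unfolding continuous_on_iff
proof (intro ballI allI impI)
  fix p :: circle and e :: real
  assume "0 < e"
  obtain x where x: "p = proj x" using proj_surj by blast
  from assms \<open>0 < e\<close> obtain d where d: "d > 0" "\<And>y. dist y x < d \<Longrightarrow> dist (q (proj y)) (q (proj x)) < e"
    unfolding continuous_on_iff by (metis UNIV_I)
  show "\<exists>d>0. \<forall>p'\<in>UNIV. dist p' p < d \<longrightarrow> dist (q p') (q p) < e"
  proof (intro exI[of _ d] conjI ballI impI d(1))
    fix p' assume less: "dist p' p < d"
    obtain y where "p' = proj y" "\<bar>y - x\<bar> = dist p' (proj x)" by (rule circle_nearest_preimage)
    then show "dist (q p') (q p) < e" using d(2)[of y] less x by (simp add: dist_real_def)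
  qed
qed

lemma compact_circle: "compact (UNIV :: circle set)"
proof -
  have "p \<in> proj ` {0..1}" for p
  proof -
    obtain x where x: "p = proj x" using proj_surj by blast
    have "proj x = proj (frac x)" by (simp add: proj_eq_iff frac_def)
    then show ?thesis using x frac_ge_0[of x] frac_lt_1[of x] by (auto intro!: image_eqI[of _ _ "frac x"])
  qed
  then have "UNIV = proj ` {0..1}" by auto
  then show ?thesis
    using compact_continuous_image[of "{0..1}" proj] continuous_on_subset[OF continuous_on_proj] by simp
qed

lemma dist_rotation: "dist (rotation t p) (rotation t q) = dist p q"
proof -
  obtain x y where "p = proj x" "q = proj y" using proj_surj by metis
  then show ?thesis by (simp add: rotation_proj dist_proj)
qed

lemma C1_circle_mapI:
  assumes "is_lift F f" "\<And>x. (F has_real_derivative g x) (at x)" "continuous_on UNIV g"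
  shows "C1_circle_map f"
  unfolding C1_circle_map_def
proof (intro conjI allI)
  fix p
  obtain x where "p = proj x" using proj_surj by blast
  then show "\<exists>d. has_circle_deriv f d p" using assms by (auto simp: has_circle_deriv_def)
next
  have "circle_deriv f (proj x) = g x" for x using assms by (intro circle_deriv_proj) auto
  then show "continuous_on UNIV (circle_deriv f)"
    using assms(3) by (intro continuous_on_circleI) simp
qed

text \<open>The choice of representative is immaterial once \<open>F\<close> commutes with integer
  translations.\<close>

definition circle_map :: "(real \<Rightarrow> real) \<Rightarrow> circle \<Rightarrow> circle" where
  "circle_map F p = proj (F (rep_circle p))"

section \<open>Circle diffeomorphisms from lifts of degree one\<close>

locale circle_diffeo_lift =
  fixes F g :: "real \<Rightarrow> real"
  assumes F_plus_1: "F (x + 1) = F x + 1"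
    and F_deriv: "(F has_real_derivative g x) (at x)"
    and g_pos: "0 < g x"
    and g_cont: "continuous_on UNIV g"
begin

lemma F_add_int: "F (x + of_int k) = F x + of_int k"
proof -
  have nat: "F (x + of_nat n) = F x + of_nat n" for x n
  proof (induction n)
    case (Suc n)
    then show ?case using F_plus_1[of "x + of_nat n"] by (simp add: algebra_simps)
  qed simp
  show ?thesis
  proof (cases k)
    case (nonneg n)
    then show ?thesis using nat by simp
  next
    case (neg n)
    then show ?thesis using nat[of "x + of_int k" "Suc n"] by simp
  qed
qed

lemma F_cont: "continuous_on UNIV F"
  using F_deriv DERIV_isCont by (auto simp: continuous_on_eq_continuous_at)

lemma F_strict_mono: "strict_mono F"
  by (rule strict_monoI, rule DERIV_pos_imp_increasing) (use F_deriv g_pos in blast)+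

lemma F_bij: "bij F"
proof (rule bijI)
  show "inj F" using F_strict_mono by (rule strict_mono_imp_inj_on)
  show "surj F"
    unfolding surj_def
  proof (intro allI)
    fix y
    \<comment> \<open>Large enough for \<open>F (- k) = F 0 - k\<close> and
      \<open>F k = F 0 + k\<close> to enclose \<open>y\<close>.\<close>
    define k where "k = \<lceil>\<bar>y - F 0\<bar>\<rceil>"
    have k: "\<bar>y - F 0\<bar> \<le> of_int k" by (simp add: k_def)
    have "\<exists>x\<ge>- of_int k. x \<le> of_int k \<and> F x = y"
      using k F_add_int[of 0 k] F_add_int[of 0 "- k"] F_cont
      by (intro IVT') (auto intro: continuous_on_subset)
    then show "\<exists>x. y = F x" by blast
  qed
qed

lemma is_lift_circle_map: "is_lift F (circle_map F)"
proof -
  have "proj (F (rep_circle (proj x))) = proj (F x)" for x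
  proof -
    have "rep_circle (proj x) - x \<in> \<int>" using proj_rep_circle[of "proj x"] by (simp add: proj_eq_iff)
    then obtain k where "rep_circle (proj x) - x = of_int k" by (rule Ints_cases)
    then have "rep_circle (proj x) = x + of_int k" by simp
    then show ?thesis by (simp add: F_add_int proj_eq_iff)
  qed
  then show ?thesis by (simp add: is_lift_def circle_map_def F_cont)
qed

lemma circle_map_proj: "circle_map F (proj x) = proj (F x)"
  using is_lift_circle_map by (simp add: is_lift_def)

lemma circle_map_bij: "bij (circle_map F)"
proof (rule bijI)
  show "inj (circle_map F)"
  proof (rule injI)
    fix p q assume eq: "circle_map F p = circle_map F q"
    obtain x y where xy: "p = proj x" "q = proj y" using proj_surj by metis
    with eq have "F x - F y \<in> \<int>" by (simp add: circle_map_proj proj_eq_iff)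
    then obtain k where "F x - F y = of_int k" by (rule Ints_cases)
    then have "F x = F (y + of_int k)" by (simp add: F_add_int)
    then have "x = y + of_int k" using F_bij by (simp add: bij_is_inj inj_eq)
    then show "p = q" using xy by (simp add: proj_eq_iff)
  qed
  show "surj (circle_map F)"
    unfolding surj_def
  proof (intro allI)
    fix p
    obtain x where "p = proj x" using proj_surj by blast
    moreover obtain y where "F y = x" using F_bij by (metis bij_pointE)
    ultimately show "\<exists>q. p = circle_map F q" using circle_map_proj by metis
  qed
qed

lemma circle_map_deriv: "circle_deriv (circle_map F) (proj x) = g x"
  by (rule circle_deriv_proj[OF is_lift_circle_map F_deriv])

lemma circle_map_Diff1: "circle_map F \<in> Diff1_plus"
proof -
  define G where "G = inv F"
  have GF: "G (F x) = x" and FG: "F (G y) = y" for x y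
    using F_bij by (simp_all add: G_def bij_is_inj bij_is_surj surj_f_inv_f)
  have cG: "isCont G y" for y
  proof -
    have "isCont G (F (G y))"
      by (rule isCont_inverse_function[where f=F and d=1]) (use GF DERIV_isCont[OF F_deriv] in auto)
    then show ?thesis by (simp add: FG)
  qed
  have dG: "(G has_real_derivative inverse (g (G y))) (at y)" for y
    by (rule DERIV_inverse_function[where f=F and a="y - 1" and b="y + 1"])
      (use F_deriv g_pos[of "G y"] FG cG in auto)
  have contG: "continuous_on UNIV G" using cG by (simp add: continuous_on_eq_continuous_at)
  have "inv (circle_map F) (proj y) = proj (G y)" for y
    using circle_map_bij circle_map_proj[of "G y"] by (metis FG bij_inv_eq_iff)
  then have "is_lift G (inv (circle_map F))" using contG by (simp add: is_lift_def)
  moreover have "continuous_on UNIV (\<lambda>y. inverse (g (G y)))"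
    using g_pos by (intro continuous_on_inverse continuous_on_compose2[OF g_cont contG])
      (auto simp: less_imp_neq[symmetric])
  ultimately have "C1_circle_map (inv (circle_map F))" using dG by (intro C1_circle_mapI)
  moreover have "C1_circle_map (circle_map F)"
    by (rule C1_circle_mapI[OF is_lift_circle_map F_deriv g_cont])
  ultimately show ?thesis
    using circle_map_bij is_lift_circle_map F_strict_mono
    by (auto simp: Diff1_plus_def orientation_preserving_def)
qed

end

lemma iterates_is_lift:
  assumes "is_lift F f"
  shows "(f ^^ n) (proj x) = proj ((F ^^ n) x)"
  using assms by (induction n) (auto simp: is_lift_def)

section \<open>The Denjoy diffeomorphism\<close>

locale denjoy_modulus = denjoy_lengths +
  fixes \<alpha> :: "real \<Rightarrow> real"
  assumes modulus: "concave_modulus \<alpha>"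
    and amp_le_modulus: "\<bar>l (n + 1) / l n - 1\<bar> \<le> 4 * \<alpha> (l n)"
begin

text \<open>The factor \<open>\<alpha> (l n)\<close> in the amplitude compensates the tent's slope
  \<open>4 / l n\<close>, by \<open>concave_modulus_min\<close>. The constant is 4 (amplitude) times
  4 (tent) times 2 (two gaps).\<close>

lemma g_modulus: "\<bar>g x - g y\<bar> \<le> 32 * \<alpha> (dist_to_Ints (x - y))"
proof -
  let ?d = "dist_to_Ints (x - y)"
  have "\<bar>amp n\<bar> * \<bar>hat (l n) (x - mid n) - hat (l n) (y - mid n)\<bar> \<le> 16 * \<alpha> ?d" for n
  proof -
    have "\<bar>hat (l n) (x - mid n) - hat (l n) (y - mid n)\<bar> \<le> 4 * min 1 (?d / l n)"
      using hat_lipschitz[OF l_pos, of n "x - mid n" "y - mid n"] by simp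
    then have "\<bar>amp n\<bar> * \<bar>hat (l n) (x - mid n) - hat (l n) (y - mid n)\<bar>
        \<le> (4 * \<alpha> (l n)) * (4 * min 1 (?d / l n))"
      using amp_le_modulus[of n] concave_modulus_pos[OF modulus l_pos, of n]
      by (intro mult_mono) (auto simp: amp_def)
    also have "\<dots> = 16 * (\<alpha> (l n) * min 1 (?d / l n))" by simp
    also have "\<dots> \<le> 16 * \<alpha> ?d"
      by (intro mult_left_mono concave_modulus_min[OF modulus l_pos] dist_to_Ints_nonneg) auto
    finally show ?thesis .
  qed
  then have "\<bar>g x - g y\<bar> \<le> 2 * (16 * \<alpha> ?d)" by (rule g_diff)
  then show ?thesis by simp
qed

lemma g_cont: "continuous_on UNIV g"
  unfolding continuous_on_iff
proof (intro ballI allI impI)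
  fix x e :: real
  assume "0 < e"
  then obtain d where d: "0 < d" "\<alpha> d \<le> e / 64"
    using concave_modulus_small[OF modulus, of "e/64"] by auto
  have "dist (g y) (g x) < e" if "dist y x < d" for y
  proof -
    have "\<alpha> (dist_to_Ints (y - x)) \<le> \<alpha> d"
      using that dist_to_Ints_le_abs[of "y - x"]
      by (intro concave_modulus_mono[OF modulus] dist_to_Ints_nonneg) (auto simp: dist_real_def)
    then show ?thesis using g_modulus[of y x] d \<open>0 < e\<close> by (simp add: dist_real_def)
  qed
  then show "\<exists>d>0. \<forall>y\<in>UNIV. dist y x < d \<longrightarrow> dist (g y) (g x) < e" using d by blast
qed

sublocale circle_diffeo_lift F g
  by unfold_locales (rule F_plus_1 F_deriv g_pos g_cont)+

abbreviation f :: "circle \<Rightarrow> circle" where "f \<equiv> circle_map F"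

lemma f_Diff1_alpha: "f \<in> Diff1_alpha_plus \<alpha>"
proof -
  have "\<bar>circle_deriv f p - circle_deriv f q\<bar> / \<alpha> (dist p q) \<le> 32" if "p \<noteq> q" for p q
  proof -
    obtain x y where xy: "p = proj x" "q = proj y" using proj_surj by metis
    have "0 < \<alpha> (dist p q)" using that by (intro concave_modulus_pos[OF modulus]) simp
    then show ?thesis using g_modulus[of x y]
      by (simp add: xy circle_map_deriv dist_proj pos_divide_le_eq)
  qed
  then have "alpha_continuous \<alpha> (circle_deriv f)"
    unfolding alpha_continuous_def by (intro bdd_aboveI[of _ 32]) auto
  then show ?thesis using circle_map_Diff1 by (simp add: Diff1_alpha_plus_def)
qed

section \<open>Orbits of the gap ends, conjugacy and rotation number\<close>

lemma F_iterate_J: "(F ^^ n) (J 0) = J (real n * \<theta>)"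
  by (induction n) (auto simp: F_J algebra_simps)

lemma F_iterate_gap: "(F ^^ n) (J 0 - l 0) = J (real n * \<theta>) - l (int n)"
proof (induction n)
  case (Suc n)
  have "real n * \<theta> - a (int n) \<in> \<int>" by (simp add: a_def frac_def)
  from F_gap[OF this] have "(F ^^ Suc n) (J 0 - l 0) = J (real n * \<theta> + \<theta>) - l (int n + 1)"
    by (simp add: Suc)
  then show ?case by (simp only: of_nat_Suc distrib_right mult_1 add.commute)
qed simp

lemma l_tendsto_0: "(\<lambda>n. l (int n)) \<longlonglongrightarrow> 0"
proof -
  have "(l \<circ> int) summable_on UNIV"
    using summable_on_subset_banach[OF l_summable, of "range int"]
    by (subst summable_on_reindex[symmetric]) auto
  then show ?thesis using summable_LIMSEQ_zero[OF summable_on_imp_summable] by (simp add: o_def)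
qed

text \<open>
  The endpoints of the gap at 0 have asymptotic forward orbits, which the isometry
  \<open>rotation t\<close> does not allow.
\<close>

lemma f_not_conjugate: "\<not> topologically_conjugate f (rotation t)"
proof
  assume "topologically_conjugate f (rotation t)"
  then obtain h h' where h: "homeomorphism UNIV UNIV h h'" and conj: "h \<circ> f = rotation t \<circ> h"
    by (auto simp: topologically_conjugate_def)
  define p where "p = proj (J 0)"
  define q where "q = proj (J 0 - l 0)"
  have "p \<noteq> q"
  proof
    assume "p = q"
    then have "l 0 \<in> \<int>" by (simp add: p_def q_def proj_eq_iff)
    then show False using Ints_nonzero_abs_ge1[of "l 0"] l_pos[of 0] l_less_1[of 0] by auto
  qed
  then have "h p \<noteq> h q" using h by (metis homeomorphism_def UNIV_I)
  then have e: "dist (h p) (h q) > 0" by simp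
  have "uniformly_continuous_on UNIV h"
    using h compact_circle by (intro compact_uniformly_continuous) (auto simp: homeomorphism_def)
  then obtain d where d: "d > 0" "\<And>u v. dist u v < d \<Longrightarrow> dist (h u) (h v) < dist (h p) (h q)"
    unfolding uniformly_continuous_on_def using e by (metis UNIV_I dist_commute)
  obtain n where n: "l (int n) < d"
    using order_tendstoD(2)[OF l_tendsto_0 d(1)] by (auto simp: eventually_sequentially)
  have "dist ((f ^^ n) p) ((f ^^ n) q) = dist_to_Ints (l (int n))"
    by (simp add: p_def q_def iterates_is_lift[OF is_lift_circle_map] F_iterate_J F_iterate_gap dist_proj)
  also have "\<dots> < d" using dist_to_Ints_le_abs[of "l (int n)"] l_pos[of "int n"] n by linarith
  finally have "dist (h ((f ^^ n) p)) (h ((f ^^ n) q)) < dist (h p) (h q)" by (rule d(2))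
  moreover have "h ((f ^^ m) u) = (rotation t ^^ m) (h u)" for m u
    using conj by (induction m) (auto simp: fun_eq_iff)
  moreover have "dist ((rotation t ^^ m) u) ((rotation t ^^ m) v) = dist u v" for m u v
    by (induction m) (simp_all add: dist_rotation)
  ultimately show False by simp
qed

lemma J_near: "\<bar>J s - s - J 0\<bar> \<le> 1"
proof -
  have "J (of_int \<lfloor>s\<rfloor>) \<le> J s" "J s \<le> J (of_int (\<lfloor>s\<rfloor> + 1))" by (intro J_mono; linarith)+
  then have "J 0 + of_int \<lfloor>s\<rfloor> \<le> J s" "J s \<le> J 0 + of_int (\<lfloor>s\<rfloor> + 1)"
    using J_add_int[of 0 "\<lfloor>s\<rfloor>"] J_add_int[of 0 "\<lfloor>s\<rfloor> + 1"] by auto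
  then show ?thesis by linarith
qed

text \<open>The orbit of \<open>J 0\<close> is explicit and stays within bounded distance of
  \<open>n * \<theta>\<close>. Iterates of \<open>F\<close> are monotone and commute with integer
  translations, so every other orbit stays at bounded distance from it.\<close>

lemma f_rotation_number: "has_rotation_number f \<theta>"
  unfolding has_rotation_number_def
proof (intro exI[of _ F] conjI allI is_lift_circle_map F_strict_mono)
  fix x
  define k where "k = \<lceil>\<bar>x - J 0\<bar>\<rceil>"
  have mono: "(F ^^ n) u \<le> (F ^^ n) v" if "u \<le> v" for n u v
    by (induction n) (use that F_strict_mono strict_mono_less_eq in auto)
  have add: "(F ^^ n) (u + of_int j) = (F ^^ n) u + of_int j" for n u j
    by (induction n) (auto simp: F_add_int)
  have k: "\<bar>x - J 0\<bar> \<le> of_int k" by (simp add: k_def)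
  define C where "C = of_int k + 1 + \<bar>J 0 - x\<bar>"
  have bound: "\<bar>(F ^^ n) x - x - real n * \<theta>\<bar> \<le> C" for n
  proof -
    have "(F ^^ n) (J 0 + of_int (- k)) \<le> (F ^^ n) x" "(F ^^ n) x \<le> (F ^^ n) (J 0 + of_int k)"
      using k by (intro mono; simp; linarith)+
    then have "\<bar>(F ^^ n) x - J (real n * \<theta>)\<bar> \<le> of_int k"
      unfolding add F_iterate_J by simp
    then show ?thesis using J_near[of "real n * \<theta>"] unfolding C_def by linarith
  qed
  have "(\<lambda>n. ((F ^^ n) x - x) / real n - \<theta>) \<longlonglongrightarrow> 0"
  proof (rule Lim_null_comparison)
    show "\<forall>\<^sub>F n in sequentially. norm (((F ^^ n) x - x) / real n - \<theta>) \<le> C / real n"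
    proof (rule eventually_sequentiallyI[of 1])
      fix n :: nat assume "1 \<le> n"
      then have "((F ^^ n) x - x) / real n - \<theta> = ((F ^^ n) x - x - real n * \<theta>) / real n"
        by (simp add: field_simps)
      then show "norm (((F ^^ n) x - x) / real n - \<theta>) \<le> C / real n"
        using bound[of n] by (simp add: divide_right_mono)
    qed
    show "(\<lambda>n. C / real n) \<longlonglongrightarrow> 0" by (rule lim_const_over_n)
  qed
  then show "(\<lambda>n. ((F ^^ n) x - x) / real n) \<longlonglongrightarrow> \<theta>" by (simp add: LIM_zero_iff)
qed

lemma f_exceptional: "exceptional f"
  unfolding exceptional_def
  using circle_map_Diff1 irrational f_rotation_number f_not_conjugate by blast

text \<open>At \<open>J 0\<close> the displacement is \<open>J \<theta> - J 0\<close>, which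
  \<open>J_increment\<close> compares with \<open>\<theta>\<close>. Elsewhere it varies by at most
  \<open>2 * \<delta>\<close>, since a lift within distance 1 of \<open>J 0\<close> can be
  chosen.\<close>

lemma f_near_rotation:
  assumes "\<And>n. \<bar>amp n\<bar> \<le> \<delta>"
  shows "dist (f p) (rotation \<theta> p) \<le> L * (2 * \<bar>\<theta>\<bar> + 1) + 2 * \<delta>"
proof -
  obtain y where y: "p = proj y" "\<bar>y - J 0\<bar> = dist p (proj (J 0))"
    by (rule circle_nearest_preimage)
  obtain x where "p = proj x" using proj_surj by blast
  have le1: "\<bar>y - J 0\<bar> \<le> 1"
    unfolding y(2) \<open>p = proj x\<close> dist_proj dist_to_Ints_def
    using of_int_round_abs_le[of "x - J 0"] by linarith
  have "\<delta> \<ge> 0" using order.trans[OF abs_ge_zero assms] .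
  have "norm ((F y - y) - (F (J 0) - J 0)) \<le> 2 * \<delta> * norm (y - J 0)"
  proof (rule field_differentiable_bound[of UNIV])
    show "((\<lambda>x. F x - x) has_field_derivative g z - 1) (at z within UNIV)" for z
      using F_deriv by (auto intro!: derivative_eq_intros)
    show "norm (g z - 1) \<le> 2 * \<delta>" for z using g_bound[OF assms] by simp
  qed auto
  also have "\<dots> \<le> 2 * \<delta> * 1" using le1 \<open>\<delta> \<ge> 0\<close> by (intro mult_left_mono) auto
  finally have "\<bar>F y - (y + \<theta>)\<bar> \<le> L * (2 * \<bar>\<theta>\<bar> + 1) + 2 * \<delta>"
    using J_increment[of 0 \<theta>] F_J[of 0] by simp
  then show ?thesis
    using dist_to_Ints_le_abs[of "F y - (y + \<theta>)"]
    by (simp add: y(1) circle_map_proj rotation_proj dist_proj)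
qed

end

section \<open>Choice of the lengths and of the closeness parameter\<close>

lemma exists_denjoy_example:
  fixes \<theta> \<epsilon> :: real and \<alpha> :: "real \<Rightarrow> real"
  assumes \<theta>: "\<theta> \<notin> \<rat>" and \<alpha>: "concave_modulus \<alpha>"
    and fin: "(\<integral>\<^sup>+ x\<in>{0..1}. ennreal (1 / \<alpha> x) \<partial>lborel) < \<infinity>"
    and \<epsilon>: "\<epsilon> > 0"
  shows "\<exists>f \<in> Diff1_alpha_plus \<alpha>. exceptional f \<and> has_rotation_number f \<theta> \<and>
       (SUP p. dist (f p) (rotation \<theta> p)) < \<epsilon> \<and>
       (SUP p. \<bar>circle_deriv f p - 1\<bar>) < \<epsilon>"
proof -
  \<comment> \<open>Both \<open>L\<close> and the amplitudes will be at most
    \<open>2 * \<delta>\<close>. The distances become at most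
    \<open>\<delta> * (4 * \<bar>\<theta>\<bar> + 6)\<close> and \<open>4 * \<delta>\<close>; 8 in
    place of 6 keeps the suprema strictly below \<open>\<epsilon>\<close>.\<close>
  define \<delta> where "\<delta> = min (1/8) (\<epsilon> / (4 * \<bar>\<theta>\<bar> + 8))"
  have \<delta>: "0 < \<delta>" "\<delta> \<le> 1/8" "\<delta> * (4 * \<bar>\<theta>\<bar> + 8) \<le> \<epsilon>"
  proof -
    have p: "0 < 4 * \<bar>\<theta>\<bar> + 8" by simp
    then show "0 < \<delta>" using \<epsilon> by (simp add: \<delta>_def)
    show "\<delta> \<le> 1/8" by (simp only: \<delta>_def min.cobounded1)
    have "\<delta> \<le> \<epsilon> / (4 * \<bar>\<theta>\<bar> + 8)" by (simp add: \<delta>_def)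
    then show "\<delta> * (4 * \<bar>\<theta>\<bar> + 8) \<le> \<epsilon>" using p by (simp only: pos_le_divide_eq)
  qed
  then have "\<delta> < 1" by simp
  from exists_gap_lengths[OF \<alpha> \<delta>(1) this fin] obtain u :: "nat \<Rightarrow> real"
    where u: "\<And>k. 0 < u k" "\<And>k. \<alpha> (u k) \<le> \<delta>"
      "\<And>k. u (Suc k) = u k * (1 - \<alpha> (u k))" "summable u" "suminf u < \<delta>" by blast
  define l where "l n = u (nat \<bar>n\<bar>)" for n :: int
  have \<alpha>u: "0 < \<alpha> (u k)" "\<alpha> (u k) \<le> 1/8" for k
    using concave_modulus_pos[OF \<alpha> u(1)] u(2)[of k] \<delta> by auto
  have amp: "\<bar>l (n + 1) / l n - 1\<bar> \<le> 2 * \<delta> \<and> \<bar>l (n + 1) / l n - 1\<bar> \<le> 4 * \<alpha> (l n)" for n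
  proof (cases "n \<ge> 0")
    case True
    define k where "k = nat n"
    have "l n = u k" "l (n + 1) = u (Suc k)" using True by (simp_all add: l_def k_def nat_add_distrib)
    then have "l (n + 1) / l n - 1 = - \<alpha> (l n)" using u(1)[of k] by (simp add: u(3))
    then show ?thesis using \<alpha>u[of k] u(2)[of k] \<delta> \<open>l n = u k\<close> by simp
  next
    case False
    \<comment> \<open>For negative \<open>n\<close> the gap grows: \<open>l n = u (Suc k)\<close> is
      followed by the longer \<open>u k\<close>.\<close>
    define k where "k = nat (- n - 1)"
    have nk: "nat (- n) = Suc k" using False by (simp add: k_def)
    have "\<bar>n + 1\<bar> = - n - 1" "\<bar>n\<bar> = - n" using False by auto
    then have lk: "l n = u (Suc k)" "l (n + 1) = u k" by (simp_all add: l_def k_def[symmetric] nk)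
    define b where "b = \<alpha> (u k)"
    have b: "0 < b" "b \<le> 1/8" "b \<le> \<delta>" using \<alpha>u[of k] u(2)[of k] by (auto simp: b_def)
    have eq: "l (n + 1) / l n - 1 = b / (1 - b)"
      unfolding lk u(3) b_def[symmetric] using u(1)[of k] b by (simp add: field_simps)
    \<comment> \<open>\<open>b\<close> is the modulus at the longer gap, but the bound must use the
      shorter one. This costs a factor \<open>1 / (1 - b)\<close>, at most 2, and
      \<open>b / (1 - b)\<close> costs another 2, hence the constant 4.\<close>
    have "(1 - b) * b \<le> \<alpha> (l n)"
      using concave_modulus_ratio[OF \<alpha>, of "1 - b" "u k"] b u(1)[of k]
      by (simp add: lk u(3) b_def[symmetric] mult.commute)
    moreover have "1/2 * b \<le> (1 - b) * b" using b by (intro mult_right_mono) auto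
    moreover have "b / (1 - b) \<le> 2 * b"
    proof -
      have "b * 1 \<le> b * (2 * (1 - b))" using b by (intro mult_left_mono) auto
      then show ?thesis using b by (simp add: pos_divide_le_eq algebra_simps)
    qed
    moreover have "0 \<le> b / (1 - b)" using b by simp
    ultimately show ?thesis unfolding eq using b by (simp only: abs_of_nonneg) argo
  qed
  have l_sum: "l summable_on UNIV" "infsum l UNIV \<le> 2 * \<delta>"
    using summable_abs_index[of u] u by (auto simp: l_def[abs_def] less_imp_le)
  interpret D: denjoy_modulus \<theta> l \<alpha>
  proof
    show "infsum l UNIV < 1" using l_sum(2) \<delta>(2) by simp
    show "\<bar>l (n + 1) / l n - 1\<bar> \<le> 1/4" for n using amp[of n] \<delta>(2) by simp
    show "\<bar>l (n + 1) / l n - 1\<bar> \<le> 4 * \<alpha> (l n)" for n using amp[of n] by simp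
    show "finite {n. e \<le> \<bar>l (n + 1) / l n - 1\<bar>}" if "0 < e" for e
    proof -
      \<comment> \<open>If \<open>l n < d\<close>, the ratio deviates from 1 by at most
        \<open>4 * \<alpha> d\<close>, hence at most \<open>e / 2\<close>.\<close>
      obtain d where d: "0 < d" "\<alpha> d \<le> e / 8"
        by (rule concave_modulus_small[OF \<alpha>, of "e / 8"]) (use \<open>0 < e\<close> in auto)
      obtain K where K: "\<And>k. k \<ge> K \<Longrightarrow> u k < d"
        using order_tendstoD(2)[OF summable_LIMSEQ_zero[OF u(4)] d(1)]
        by (auto simp: eventually_sequentially)
      have "n \<in> {- int K..int K}" if "e \<le> \<bar>l (n + 1) / l n - 1\<bar>" for n
      proof (rule ccontr)
        assume "n \<notin> {- int K..int K}"
        then have "K \<le> nat \<bar>n\<bar>" by auto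
        then have "l n < d" using K by (simp add: l_def)
        then have "\<alpha> (l n) \<le> \<alpha> d" using u(1) by (intro concave_modulus_mono[OF \<alpha>]) (auto simp: l_def less_imp_le)
        then show False using amp[of n] that d \<open>0 < e\<close> by linarith
      qed
      then have "{n. e \<le> \<bar>l (n + 1) / l n - 1\<bar>} \<subseteq> {- int K..int K}" by blast
      then show ?thesis by (rule finite_subset) simp
    qed
    show "0 < l n" for n by (simp add: l_def u(1))
  qed (fact \<theta> \<alpha> l_sum(1))+
  have amp': "\<bar>D.amp n\<bar> \<le> 2 * \<delta>" for n using amp[of n] by (simp add: D.amp_def)
  have c0: "dist (D.f p) (rotation \<theta> p) \<le> \<delta> * (4 * \<bar>\<theta>\<bar> + 6)" for p
  proof -
    have "dist (D.f p) (rotation \<theta> p) \<le> D.L * (2 * \<bar>\<theta>\<bar> + 1) + 2 * (2 * \<delta>)"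
      by (rule D.f_near_rotation[OF amp'])
    also have "\<dots> \<le> (2 * \<delta>) * (2 * \<bar>\<theta>\<bar> + 1) + 2 * (2 * \<delta>)"
      using l_sum(2) by (intro add_right_mono mult_right_mono) (auto simp: D.L_def)
    finally show ?thesis by (simp add: algebra_simps)
  qed
  have c1: "\<bar>circle_deriv D.f p - 1\<bar> \<le> \<delta> * 4" for p
  proof -
    obtain x where "p = proj x" using proj_surj by blast
    then show ?thesis using D.g_bound[OF amp', of x] by (simp add: D.circle_map_deriv)
  qed
  have "\<delta> * (4 * \<bar>\<theta>\<bar> + 6) < \<epsilon>" "\<delta> * 4 < \<epsilon>"
  proof -
    have "\<delta> * (4 * \<bar>\<theta>\<bar> + 6) < \<delta> * (4 * \<bar>\<theta>\<bar> + 8)" "\<delta> * 4 < \<delta> * (4 * \<bar>\<theta>\<bar> + 8)"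
      using \<delta>(1) by (intro mult_strict_left_mono; linarith)+
    then show "\<delta> * (4 * \<bar>\<theta>\<bar> + 6) < \<epsilon>" "\<delta> * 4 < \<epsilon>" using \<delta>(3) by linarith+
  qed
  moreover have "(SUP p. dist (D.f p) (rotation \<theta> p)) \<le> \<delta> * (4 * \<bar>\<theta>\<bar> + 6)"
    by (rule cSUP_least) (use c0 in auto)
  moreover have "(SUP p. \<bar>circle_deriv D.f p - 1\<bar>) \<le> \<delta> * 4"
    by (rule cSUP_least) (use c1 in auto)
  ultimately show ?thesis
    using D.f_Diff1_alpha D.f_exceptional D.f_rotation_number
    by (intro bexI[of _ D.f] conjI) auto
qed

theorem theorem1p2:
  fixes \<theta> :: real and \<alpha> :: "real \<Rightarrow> real"
  assumes "\<theta> \<notin> \<rat>"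
    and "concave_modulus \<alpha>"
    and "(\<integral>\<^sup>+ x\<in>{0..1}. ennreal (1 / \<alpha> x) \<partial>lborel) < \<infinity>"
  shows "(\<exists>f \<in> Diff1_alpha_plus \<alpha>. exceptional f \<and> has_rotation_number f \<theta>) \<and>
    (\<forall>\<epsilon>>0. \<exists>f \<in> Diff1_alpha_plus \<alpha>. exceptional f \<and> has_rotation_number f \<theta> \<and>
       (SUP p. dist (f p) (rotation \<theta> p)) < \<epsilon> \<and>
       (SUP p. \<bar>circle_deriv f p - 1\<bar>) < \<epsilon>)"
  \<comment> \<open>The first conjunct is the case \<open>\<epsilon> = 1\<close>.\<close>
  using exists_denjoy_example[OF assms] zero_less_one by blast

end
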